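(* Let $p>5$, let $\gamma_0\in W^{4(1-\frac1p),p}([-1,1],\mathbb{R}^n)$ be an immersion with $\mathcal{E}(\gamma_0)>0$ satisfying (FBC), let $T>0$, let $\gamma\colon[0,T)\times[-1,1]\to\mathbb{R}^n$ be a solution of (GP) with initial datum $\gamma_0$ (see the context for (FBC) and (GP)), and let $\varepsilon\in(0,T)$. Then there exists a smooth family of diffeomorphisms $\phi\colon[0,T)\times[-1,1]\to[-1,1]$ such that $\phi(t,\cdot)=\mathrm{id}_{[-1,1]}$ for all $0\le t<\frac12\varepsilon$ and such that, writing $\tilde\gamma(t,x)=\gamma(t,\phi(t,x))$, $\tilde\gamma$ again solves (GP) on $[0,T)\times[-1,1]$ and, additionally, $$\partial_t\tilde\gamma(t,x)=-\big(\nabla\mathcal{E}(\tilde\gamma(t,\cdot))(x)-\lambda(\tilde\gamma(t,\cdot))\,\vec\kappa_{\tilde\gamma}(t,x)\big)\quad\text{on }(\varepsilon,T)\times[-1,1].$$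
   Context: Standing assumptions on $M$: $n\ge2$, $M\subseteq\mathbb{R}^n$ is a complete embedded hypersurface with smooth unit normal field $\xi\colon M\to\mathbb{S}^{n-1}$, and there is $\delta>0$ such that $\Phi^M\colon M\times(-\delta,\delta)\to B_\delta(M)$, $(x,r)\mapsto x+r\xi(x)$, is a smooth diffeomorphism onto the $\delta$-neighbourhood of $M$ and, for every $k\in\mathbb{N}$, $|D^k\Phi^M|$ and $|D^k(\Phi^M)^{-1}|$ are bounded. The shape operator is $S_pX=-D_X\xi(p)$ for $X\in T_pM$. For an immersion $\gamma\colon[-1,1]\to\mathbb{R}^n$: $\partial_s=\frac1{|\partial_x\gamma|}\partial_x$, $\mathrm{d}s=|\partial_x\gamma|\,\mathrm{d}x$, $\vec\kappa=\vec\kappa_\gamma=\partial_s^2\gamma$, $\Phi^\bot=\Phi-\langle\Phi,\partial_s\gamma\rangle\partial_s\gamma$, $\partial_s^\bot\Phi=(\partial_s\Phi)^\bot$, $\partial_t^\bot\Phi=(\partial_t\Phi)^\bot$, $\mathcal{E}(\gamma)=\int_{-1}^1|\vec\kappa|^2\,\mathrm{d}s$, $\nabla\mathcal{E}(\gamma)=2(\partial_s^\bot)^2\vec\kappa+|\vec\kappa|^2\vec\kappa$, $\lambda(\gamma)=\mathcal{E}(\gamma)^{-1}\int_{-1}^1\langle\nabla\mathcal{E}(\gamma),\vec\kappa\rangle\,\mathrm{d}s$. (FBC): $\gamma(\pm1)\in M$, $\partial_s\gamma(\pm1)\perp T_{\gamma(\pm1)}M$, $\partial_s^\bot\vec\kappa(\pm1)=-\langle\partial_s\gamma(\pm1),\xi(\gamma(\pm1))\rangle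 S_{\gamma(\pm1)}\vec\kappa(\pm1)$. A solution of (GP) on $[0,T)\times[-1,1]$ with initial datum $\gamma_0$ is a family of immersions $\gamma\colon[0,T)\times[-1,1]\to\mathbb{R}^n$ with $\gamma\in C^\infty((0,T)\times[-1,1])$, $t\mapsto\gamma(t,\cdot)$ continuous from $[0,T)$ to $W^{4(1-\frac1p),p}([-1,1])$, $\gamma(0,\cdot)=\gamma_0$, $\gamma(t,\cdot)$ satisfying (FBC) for all $0\le t<T$, and $\partial_t^\bot\gamma(t,x)=-(\nabla\mathcal{E}(\gamma(t,\cdot))(x)-\lambda(\gamma(t,\cdot))\vec\kappa(t,x))$ on $(0,T)\times[-1,1]$. $W^{s,p}$ denotes the Sobolev–Slobodetskii space. *)

theory Defs
  imports "HOL-Analysis.Analysis"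
begin

section \<open>Smooth maps\<close>

text \<open>
  Derivatives are relative to \<open>S\<close>.  This is the usual notion on open sets and on convex sets with
  nonempty interior (products of intervals, possibly containing boundary points), where derivatives
  are unique; the notion is only used for such \<open>S\<close>.
\<close>

primrec Ck_on :: "nat \<Rightarrow> 'a::euclidean_space set \<Rightarrow> ('a \<Rightarrow> 'b::real_normed_vector) \<Rightarrow> bool" where
  "Ck_on 0 S f \<longleftrightarrow> continuous_on S f"
| "Ck_on (Suc k) S f \<longleftrightarrow>
     (\<exists>f'. (\<forall>x\<in>S. (f has_derivative f' x) (at x within S)) \<and> (\<forall>v. Ck_on k S (\<lambda>x. f' x v)))"

definition smooth_on :: "'a::euclidean_space set \<Rightarrow> ('a \<Rightarrow> 'b::real_normed_vector) \<Rightarrow> bool" where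
  "smooth_on S f \<longleftrightarrow> (\<forall>k. Ck_on k S f)"

text \<open>Smoothness on a submanifold of Euclidean space: locally a restriction of a smooth map.\<close>

definition smooth_map :: "'a::euclidean_space set \<Rightarrow> ('a \<Rightarrow> 'b::real_normed_vector) \<Rightarrow> bool" where
  "smooth_map A f \<longleftrightarrow>
     (\<forall>a\<in>A. \<exists>U F. open U \<and> a \<in> U \<and> smooth_on U F \<and> (\<forall>x\<in>A \<inter> U. F x = f x))"

definition diffeomorphism ::
    "'a::euclidean_space set \<Rightarrow> 'b::euclidean_space set \<Rightarrow> ('a \<Rightarrow> 'b) \<Rightarrow> bool" where
  "diffeomorphism A B f \<longleftrightarrow>
     bij_betw f A B \<and> smooth_map A f \<and> smooth_map B (the_inv_into A f)"


section \<open>Submanifolds of Euclidean space\<close>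

definition embedded_hypersurface :: "'a::euclidean_space set \<Rightarrow> bool" where
  "embedded_hypersurface M \<longleftrightarrow>
     (\<forall>p\<in>M. \<exists>U V. \<exists>\<psi> :: 'a \<Rightarrow> 'a. \<exists>b\<in>Basis. open U \<and> p \<in> U \<and> open V \<and>
        diffeomorphism U V \<psi> \<and> \<psi> ` (M \<inter> U) = {y \<in> V. y \<bullet> b = 0})"

definition tangent_space :: "'a::euclidean_space set \<Rightarrow> 'a \<Rightarrow> 'a set" where
  "tangent_space N p =
     {v. \<exists>c e. 0 < e \<and> smooth_on {-e<..<e} c \<and> c ` {-e<..<e} \<subseteq> N \<and> c 0 = p \<and>
         (c has_vector_derivative v) (at (0::real))}"

text \<open>The orthogonal projection onto \<open>tangent_space N p\<close>, a linear subspace if \<open>N\<close> is a submanifold.\<close>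

definition tangent_proj :: "'a::euclidean_space set \<Rightarrow> 'a \<Rightarrow> 'a \<Rightarrow> 'a" where
  "tangent_proj N p = closest_point (tangent_space N p)"

text \<open>
  On a submanifold \<open>N\<close>, a derivative of \<open>f\<close> at \<open>p\<close> within \<open>N\<close> is determined on tangent vectors only,
  so it is only applied to those; there it is the differential of \<open>f\<close>.
\<close>

definition tangential_deriv ::
    "'a::euclidean_space set \<Rightarrow> ('a \<Rightarrow> 'b::real_normed_vector) \<Rightarrow> 'a \<Rightarrow> 'a \<Rightarrow> 'b" where
  "tangential_deriv N f p v = frechet_derivative f (at p within N) v"

text \<open>
  \<open>cov_deriv N f [v\<^sub>1, \<dots>, v\<^sub>k] p\<close> is the \<open>k\<close>-th covariant derivative of the vector-valued function
  \<open>f\<close> on \<open>N\<close>, with the Levi-Civita connection of the metric induced on \<open>N\<close>, evaluated at \<open>p\<close> on the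
  tangential parts of the vectors \<open>v\<^sub>i\<close>.  If \<open>P\<close> denotes the tangential projection, the connection
  satisfies \<open>(\<nabla>\<^sub>X A)(Y, \<dots>) = D\<^sub>X (q \<mapsto> A\<^sub>q (P\<^sub>q Y, \<dots>))\<close> for a covariant tensor \<open>A\<close> and \<open>Y\<close> tangent at
  \<open>p\<close>, because the vector field \<open>q \<mapsto> P\<^sub>q Y\<close> has vanishing covariant derivative at \<open>p\<close>.
  If \<open>N\<close> is open, this is the iterated Frechet derivative.
\<close>

function cov_deriv ::
    "'a::euclidean_space set \<Rightarrow> ('a \<Rightarrow> 'b::real_normed_vector) \<Rightarrow> 'a list \<Rightarrow> 'a \<Rightarrow> 'b" where
  "cov_deriv N f [] p = f p"
| "cov_deriv N f (v # vs) p =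
     tangential_deriv N (\<lambda>q. cov_deriv N f (map (tangent_proj N p) vs) q) p (tangent_proj N p v)"
  by pat_completeness auto
termination by (relation "Wellfounded.measure (\<lambda>(N, f, vs, p). length vs)") auto

text \<open>\<open>\<bar>D\<^sup>k f\<bar>\<close> is bounded on \<open>N\<close>, in terms of the operator norm of multilinear maps.\<close>

definition bounded_kth_deriv ::
    "nat \<Rightarrow> 'a::euclidean_space set \<Rightarrow> ('a \<Rightarrow> 'b::real_normed_vector) \<Rightarrow> bool" where
  "bounded_kth_deriv k N f \<longleftrightarrow>
     (\<exists>C. \<forall>p\<in>N. \<forall>vs. length vs = k \<and> (\<forall>v\<in>set vs. norm v \<le> 1) \<longrightarrow> norm (cov_deriv N f vs p) \<le> C)"

definition curve_length :: "(real \<Rightarrow> 'a::euclidean_space) \<Rightarrow> real" where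
  "curve_length c = integral {0..1} (\<lambda>t. norm (vector_derivative c (at t)))"

text \<open>The Riemannian distance; it is \<open>\<infinity>\<close> between different components.\<close>

definition intrinsic_dist :: "'a::euclidean_space set \<Rightarrow> 'a \<Rightarrow> 'a \<Rightarrow> ereal" where
  "intrinsic_dist M x y =
     (INF c \<in> {c. valid_path c \<and> path_image c \<subseteq> M \<and> pathstart c = x \<and> pathfinish c = y}.
        ereal (curve_length c))"

definition intrinsically_complete :: "'a::euclidean_space set \<Rightarrow> bool" where
  "intrinsically_complete M \<longleftrightarrow>
     (\<forall>X::nat \<Rightarrow> 'a. range X \<subseteq> M \<and>
        (\<forall>e>0. \<exists>N. \<forall>m\<ge>N. \<forall>n\<ge>N. intrinsic_dist M (X m) (X n) < ereal e) \<longrightarrow>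
        (\<exists>l\<in>M. (\<lambda>n. intrinsic_dist M (X n) l) \<longlonglongrightarrow> 0))"

definition unit_normal_field :: "'a::euclidean_space set \<Rightarrow> ('a \<Rightarrow> 'a) \<Rightarrow> bool" where
  "unit_normal_field M \<xi> \<longleftrightarrow>
     smooth_map M \<xi> \<and> (\<forall>p\<in>M. norm (\<xi> p) = 1 \<and> (\<forall>v\<in>tangent_space M p. \<xi> p \<bullet> v = 0))"

definition tubular_map :: "('a::euclidean_space \<Rightarrow> 'a) \<Rightarrow> 'a \<times> real \<Rightarrow> 'a" where
  "tubular_map \<xi> = (\<lambda>(x, r). x + r *\<^sub>R \<xi> x)"

text \<open>
  Bounds are required for derivatives of order at least one: a bound on the maps themselves would
  force \<open>M\<close> to be bounded.
\<close>

definition uniform_tubular_neighbourhood ::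
    "'a::euclidean_space set \<Rightarrow> ('a \<Rightarrow> 'a) \<Rightarrow> real \<Rightarrow> bool" where
  "uniform_tubular_neighbourhood M \<xi> \<delta> \<longleftrightarrow>
     (let N = M \<times> {-\<delta><..<\<delta>}; B = (\<Union>x\<in>M. ball x \<delta>) in
        diffeomorphism N B (tubular_map \<xi>) \<and>
        (\<forall>k\<ge>1. bounded_kth_deriv k N (tubular_map \<xi>) \<and>
               bounded_kth_deriv k B (the_inv_into N (tubular_map \<xi>))))"

definition admissible_hypersurface :: "'a::euclidean_space set \<Rightarrow> ('a \<Rightarrow> 'a) \<Rightarrow> bool" where
  "admissible_hypersurface M \<xi> \<longleftrightarrow>
     embedded_hypersurface M \<and> intrinsically_complete M \<and> unit_normal_field M \<xi> \<and>
     (\<exists>\<delta>>0. uniform_tubular_neighbourhood M \<xi> \<delta>)"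

definition shape_operator :: "'a::euclidean_space set \<Rightarrow> ('a \<Rightarrow> 'a) \<Rightarrow> 'a \<Rightarrow> 'a \<Rightarrow> 'a" where
  "shape_operator M \<xi> p X = - tangential_deriv M \<xi> p X"


section \<open>Sobolev--Slobodetskii spaces on \<open>[-1,1]\<close>\<close>

definition test_function :: "(real \<Rightarrow> real) \<Rightarrow> bool" where
  "test_function \<eta> \<longleftrightarrow>
     smooth_on UNIV \<eta> \<and> (\<exists>a b. -1 < a \<and> b < 1 \<and> (\<forall>x. x \<notin> {a..b} \<longrightarrow> \<eta> x = 0))"

definition is_weak_deriv ::
    "nat \<Rightarrow> (real \<Rightarrow> 'a::euclidean_space) \<Rightarrow> (real \<Rightarrow> 'a) \<Rightarrow> bool" where
  "is_weak_deriv j f g \<longleftrightarrow>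
     g absolutely_integrable_on {-1..1} \<and>
     (\<forall>\<eta>. test_function \<eta> \<longrightarrow>
        integral {-1..1} (\<lambda>x. (deriv ^^ j) \<eta> x *\<^sub>R f x) =
        (-1) ^ j *\<^sub>R integral {-1..1} (\<lambda>x. \<eta> x *\<^sub>R g x))"

text \<open>A representative of the weak derivative, which is unique up to null sets.\<close>

definition weak_deriv :: "nat \<Rightarrow> (real \<Rightarrow> 'a::euclidean_space) \<Rightarrow> real \<Rightarrow> 'a" where
  "weak_deriv j f = (SOME g. is_weak_deriv j f g)"

definition gagliardo_integrand ::
    "real \<Rightarrow> real \<Rightarrow> (real \<Rightarrow> 'a::euclidean_space) \<Rightarrow> real \<times> real \<Rightarrow> real" where
  "gagliardo_integrand \<theta> p g = (\<lambda>(x, y). norm (g x - g y) powr p / \<bar>x - y\<bar> powr (1 + \<theta> * p))"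

text \<open>
  For \<open>s \<ge> 0\<close> and \<open>1 \<le> p < \<infinity>\<close>: weak derivatives up to order \<open>\<lfloor>s\<rfloor>\<close> are \<open>p\<close>-integrable, and for
  non-integer \<open>s\<close> the Gagliardo seminorm of order \<open>frac s\<close> of the highest one is finite.
\<close>

definition in_Wsp :: "real \<Rightarrow> real \<Rightarrow> (real \<Rightarrow> 'a::euclidean_space) \<Rightarrow> bool" where
  "in_Wsp s p f \<longleftrightarrow>
     f absolutely_integrable_on {-1..1} \<and>
     (\<forall>j \<le> nat \<lfloor>s\<rfloor>. (\<exists>g. is_weak_deriv j f g) \<and>
        (\<lambda>x. norm (weak_deriv j f x) powr p) absolutely_integrable_on {-1..1}) \<and>
     (frac s > 0 \<longrightarrow>
        gagliardo_integrand (frac s) p (weak_deriv (nat \<lfloor>s\<rfloor>) f)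
          absolutely_integrable_on ({-1..1} \<times> {-1..1}))"

definition Wsp_norm :: "real \<Rightarrow> real \<Rightarrow> (real \<Rightarrow> 'a::euclidean_space) \<Rightarrow> real" where
  "Wsp_norm s p f =
     ((\<Sum>j \<le> nat \<lfloor>s\<rfloor>. integral {-1..1} (\<lambda>x. norm (weak_deriv j f x) powr p)) +
      (if frac s > 0
       then integral ({-1..1} \<times> {-1..1})
              (gagliardo_integrand (frac s) p (weak_deriv (nat \<lfloor>s\<rfloor>) f))
       else 0)) powr (1 / p)"

definition continuous_into_Wsp ::
    "real \<Rightarrow> real \<Rightarrow> real set \<Rightarrow> (real \<Rightarrow> real \<Rightarrow> 'a::euclidean_space) \<Rightarrow> bool" where
  "continuous_into_Wsp s p I \<gamma> \<longleftrightarrow>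
     (\<forall>t\<in>I. in_Wsp s p (\<gamma> t)) \<and>
     (\<forall>t\<in>I. ((\<lambda>\<tau>. Wsp_norm s p (\<lambda>x. \<gamma> \<tau> x - \<gamma> t x)) \<longlongrightarrow> 0) (at t within I))"


section \<open>Geometry of curves on \<open>[-1,1]\<close>\<close>

definition dx :: "(real \<Rightarrow> 'a::euclidean_space) \<Rightarrow> real \<Rightarrow> 'a" where
  "dx f x = vector_derivative f (at x within {-1..1})"

definition immersion :: "(real \<Rightarrow> 'a::euclidean_space) \<Rightarrow> bool" where
  "immersion c \<longleftrightarrow> Ck_on 1 {-1..1} c \<and> (\<forall>x\<in>{-1..1}. dx c x \<noteq> 0)"

definition ds :: "(real \<Rightarrow> 'a::euclidean_space) \<Rightarrow> (real \<Rightarrow> 'a) \<Rightarrow> real \<Rightarrow> 'a" where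
  "ds c \<Phi> x = (1 / norm (dx c x)) *\<^sub>R dx \<Phi> x"

definition curvature :: "(real \<Rightarrow> 'a::euclidean_space) \<Rightarrow> real \<Rightarrow> 'a" where
  "curvature c = ds c (ds c c)"

definition perp :: "(real \<Rightarrow> 'a::euclidean_space) \<Rightarrow> (real \<Rightarrow> 'a) \<Rightarrow> real \<Rightarrow> 'a" where
  "perp c \<Phi> x = \<Phi> x - (\<Phi> x \<bullet> ds c c x) *\<^sub>R ds c c x"

definition ds_perp :: "(real \<Rightarrow> 'a::euclidean_space) \<Rightarrow> (real \<Rightarrow> 'a) \<Rightarrow> real \<Rightarrow> 'a" where
  "ds_perp c \<Phi> = perp c (ds c \<Phi>)"

definition arclength_integral :: "(real \<Rightarrow> 'a::euclidean_space) \<Rightarrow> (real \<Rightarrow> real) \<Rightarrow> real" where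
  "arclength_integral c h = integral {-1..1} (\<lambda>x. h x * norm (dx c x))"

definition energy :: "(real \<Rightarrow> 'a::euclidean_space) \<Rightarrow> real" where
  "energy c = arclength_integral c (\<lambda>x. (norm (curvature c x))\<^sup>2)"

definition grad_energy :: "(real \<Rightarrow> 'a::euclidean_space) \<Rightarrow> real \<Rightarrow> 'a" where
  "grad_energy c x =
     2 *\<^sub>R ds_perp c (ds_perp c (curvature c)) x + (norm (curvature c x))\<^sup>2 *\<^sub>R curvature c x"

definition lambda :: "(real \<Rightarrow> 'a::euclidean_space) \<Rightarrow> real" where
  "lambda c = arclength_integral c (\<lambda>x. grad_energy c x \<bullet> curvature c x) / energy c"

definition FBC :: "'a::euclidean_space set \<Rightarrow> ('a \<Rightarrow> 'a) \<Rightarrow> (real \<Rightarrow> 'a) \<Rightarrow> bool" where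
  "FBC M \<xi> c \<longleftrightarrow>
     (\<forall>x\<in>{-1, 1}.
        c x \<in> M \<and>
        (\<forall>v\<in>tangent_space M (c x). ds c c x \<bullet> v = 0) \<and>
        ds_perp c (curvature c) x =
          - ((ds c c x \<bullet> \<xi> (c x)) *\<^sub>R shape_operator M \<xi> (c x) (curvature c x)))"


section \<open>The flow\<close>

definition dt :: "(real \<Rightarrow> real \<Rightarrow> 'a::euclidean_space) \<Rightarrow> real \<Rightarrow> real \<Rightarrow> 'a" where
  "dt \<gamma> t x = vector_derivative (\<lambda>\<tau>. \<gamma> \<tau> x) (at t)"

text \<open>
  Positivity of the energy makes explicit that the quotient in \<open>lambda (\<gamma> t)\<close> has to be defined
  (division by zero would silently yield zero).
\<close>

definition GP_solution ::
    "'a::euclidean_space set \<Rightarrow> ('a \<Rightarrow> 'a) \<Rightarrow> real \<Rightarrow> real \<Rightarrow> (real \<Rightarrow> 'a) \<Rightarrow>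
      (real \<Rightarrow> real \<Rightarrow> 'a) \<Rightarrow> bool" where
  "GP_solution M \<xi> p T \<gamma>\<^sub>0 \<gamma> \<longleftrightarrow>
     (\<forall>t\<in>{0..<T}. immersion (\<gamma> t)) \<and>
     smooth_on ({0<..<T} \<times> {-1..1}) (\<lambda>(t, x). \<gamma> t x) \<and>
     continuous_into_Wsp (4 * (1 - 1 / p)) p {0..<T} \<gamma> \<and>
     (\<forall>x\<in>{-1..1}. \<gamma> 0 x = \<gamma>\<^sub>0 x) \<and>
     (\<forall>t\<in>{0..<T}. FBC M \<xi> (\<gamma> t)) \<and>
     (\<forall>t\<in>{0<..<T}. energy (\<gamma> t) > 0 \<and>
        (\<forall>x\<in>{-1..1}.
           perp (\<gamma> t) (dt \<gamma> t) x =
             - (grad_energy (\<gamma> t) x - lambda (\<gamma> t) *\<^sub>R curvature (\<gamma> t) x)))"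

definition smooth_diffeo_family :: "real \<Rightarrow> (real \<Rightarrow> real \<Rightarrow> real) \<Rightarrow> bool" where
  "smooth_diffeo_family T \<phi> \<longleftrightarrow>
     smooth_on ({0..<T} \<times> {-1..1}) (\<lambda>(t, x). \<phi> t x) \<and>
     (\<forall>t\<in>{0..<T}. bij_betw (\<phi> t) {-1..1} {-1..1} \<and>
        smooth_on {-1..1} (\<phi> t) \<and> smooth_on {-1..1} (the_inv_into {-1..1} (\<phi> t)))"

end

theory Submission
  imports Defs
begin

text \<open>
  The flow equation prescribes the normal component of the velocity only, and its right-hand side,
  like the boundary conditions, is geometric.  Hence \<open>\<gamma> (t, \<phi> (t, x))\<close> is a solution again for every
  smooth family \<open>\<phi>\<close> of increasing diffeomorphisms of \<open>[-1,1]\<close>, as long as nothing is changed near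
  \<open>t = 0\<close>, where \<open>\<gamma>\<close> need not be smooth.  Its velocity is \<open>\<gamma>\<^sub>t + \<phi>\<^sub>t \<gamma>\<^sub>x\<close>, evaluated at \<open>(t, \<phi>)\<close>; this is normal
  if and only if \<open>\<phi>\<^sub>t = - h (t, \<phi>)\<close> with \<open>h = \<langle>\<gamma>\<^sub>t, \<gamma>\<^sub>x\<rangle> / \<bar>\<gamma>\<^sub>x\<bar>\<^sup>2\<close>.  So \<open>\<phi>\<close> is taken to be the flow of the time
  dependent vector field \<open>b = - \<eta> h\<close>, where the cutoff \<open>\<eta> (t)\<close> vanishes for \<open>t \<le> \<epsilon>/2\<close> and equals one
  for \<open>t \<ge> \<epsilon>\<close>.  The flow preserves \<open>[-1,1]\<close> because \<open>h (t, \<plusminus>1) = 0\<close>: the end points of the curve move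
  inside the hypersurface \<open>M\<close>, so their velocity is tangent to \<open>M\<close> (\<open>velocity_in_tangent_space\<close>), whereas
  the curve is orthogonal to \<open>M\<close> there.

  Three parts need work.  Existence and joint smoothness of the flow, including the boundary of
  \<open>[0,T) \<times> [-1,1]\<close>, is \<open>smooth_flow_exists\<close>; in one space dimension the space derivative of a flow is an
  explicit exponential integral, which turns smooth dependence on the initial value into a
  bootstrap.  Invariance of the geometric quantities rests on the chain
  rule for \<open>\<partial>\<^sub>s\<close> (\<open>ds_reparam\<close>).  Continuity in time with values in \<open>W\<^sup>s\<^sup>,\<^sup>p\<close> is inherited from \<open>\<gamma>\<close> for
  \<open>t < \<epsilon>/2\<close>, and follows from smoothness for \<open>t > 0\<close> because the \<open>C\<^sup>4\<close> norm controls the \<open>W\<^sup>s\<^sup>,\<^sup>p\<close> norm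
  (\<open>smooth_Wsp\<close>); as weak derivatives are determined up to null sets, this rests on the fundamental
  lemma of the calculus of variations.
\<close>

section \<open>Calculus of k times differentiable maps\<close>

lemma Ck_on_cong:
  assumes "\<And>x. x \<in> S \<Longrightarrow> f x = g x"
  shows "Ck_on k S f \<longleftrightarrow> Ck_on k S g"
proof (cases k)
  case 0
  then show ?thesis using assms by (simp cong: continuous_on_cong)
next
  case (Suc m)
  have "(f has_derivative d) (at x within S) \<longleftrightarrow> (g has_derivative d) (at x within S)" if "x \<in> S" for x d
    using assms that has_derivative_transform[of x S f g] has_derivative_transform[of x S g f]
    by metis
  then show ?thesis using Suc assms by (simp cong: ball_cong)
qed

lemma smooth_on_cong:
  assumes "\<And>x. x \<in> S \<Longrightarrow> f x = g x"
  shows "smooth_on S f \<longleftrightarrow> smooth_on S g"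
  using Ck_on_cong[of S f g] assms by (simp add: smooth_on_def)

lemma Ck_on_SucD: "Ck_on (Suc k) S f \<Longrightarrow> Ck_on k S f"
proof (induction k arbitrary: f)
  case 0
  then show ?case
    by (auto simp: continuous_on_eq_continuous_within intro: has_derivative_continuous)
next
  case (Suc k)
  from Suc.prems obtain f' where "\<forall>x\<in>S. (f has_derivative f' x) (at x within S)"
      "\<forall>v. Ck_on (Suc k) S (\<lambda>x. f' x v)" unfolding Ck_on.simps(2)[of "Suc k"] by blast
  then show ?case
    unfolding Ck_on.simps(2)[of k] by (intro exI[of _ f'] conjI ballI allI Suc.IH) simp_all
qed

lemma Ck_on_le: "j \<le> k \<Longrightarrow> Ck_on k S f \<Longrightarrow> Ck_on j S f"
  by (induction rule: inc_induct) (use Ck_on_SucD in blast)+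

lemma Ck_on_subset: "Ck_on k S f \<Longrightarrow> R \<subseteq> S \<Longrightarrow> Ck_on k R f"
proof (induction k arbitrary: f)
  case 0
  then show ?case by (auto intro: continuous_on_subset)
next
  case (Suc k)
  then obtain f' where f': "\<forall>x\<in>S. (f has_derivative f' x) (at x within S)"
      "\<forall>v. Ck_on k S (\<lambda>x. f' x v)" by auto
  show ?case
    unfolding Ck_on.simps
  proof (intro exI[of _ f'] conjI ballI allI)
    show "(f has_derivative f' x) (at x within R)" if "x \<in> R" for x
      using f'(1) Suc.prems(2) that has_derivative_subset by blast
    show "Ck_on k R (\<lambda>x. f' x v)" for v
      using Suc.IH f'(2) Suc.prems(2) by blast
  qed
qed

lemma Ck_on_const: "Ck_on k S (\<lambda>x. c)"
proof (induction k arbitrary: c)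
  case (Suc k)
  then show ?case unfolding Ck_on.simps
    by (intro exI[of _ "\<lambda>x h. 0"] conjI ballI allI has_derivative_const)
qed simp

lemma Ck_on_linear: "bounded_linear f \<Longrightarrow> Ck_on k S f"
proof (cases k)
  case (Suc m)
  assume "bounded_linear f"
  then show ?thesis
    unfolding Suc Ck_on.simps
    by (intro exI[of _ "\<lambda>x. f"] conjI ballI allI bounded_linear_imp_has_derivative Ck_on_const)
qed (auto intro: linear_continuous_on)

lemma Ck_on_add: "Ck_on k S f \<Longrightarrow> Ck_on k S g \<Longrightarrow> Ck_on k S (\<lambda>x. f x + g x)"
proof (induction k arbitrary: f g)
  case 0
  then show ?case by (auto intro: continuous_on_add)
next
  case (Suc k)
  from Suc.prems obtain f' where f': "\<forall>x\<in>S. (f has_derivative f' x) (at x within S)"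
      "\<forall>v. Ck_on k S (\<lambda>x. f' x v)" by auto
  from Suc.prems obtain g' where g': "\<forall>x\<in>S. (g has_derivative g' x) (at x within S)"
      "\<forall>v. Ck_on k S (\<lambda>x. g' x v)" by auto
  show ?case
    unfolding Ck_on.simps
    by (intro exI[of _ "\<lambda>x v. f' x v + g' x v"] conjI ballI allI has_derivative_add Suc.IH)
       (use f' g' in blast)+
qed

lemma (in bounded_bilinear) Ck_on:
  "Ck_on k S f \<Longrightarrow> Ck_on k S g \<Longrightarrow> Ck_on k S (\<lambda>x. prod (f x) (g x))"
proof (induction k arbitrary: f g)
  case 0
  then show ?case by (auto intro: continuous_on)
next
  case (Suc k)
  from Suc.prems obtain f' where f': "\<forall>x\<in>S. (f has_derivative f' x) (at x within S)"
      "\<forall>v. Ck_on k S (\<lambda>x. f' x v)" by auto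
  from Suc.prems obtain g' where g': "\<forall>x\<in>S. (g has_derivative g' x) (at x within S)"
      "\<forall>v. Ck_on k S (\<lambda>x. g' x v)" by auto
  show ?case
    unfolding Ck_on.simps
    by (intro exI[of _ "\<lambda>x v. prod (f x) (g' x v) + prod (f' x v) (g x)"] conjI ballI allI
          FDERIV Ck_on_add Suc.IH Suc.prems[THEN Ck_on_SucD])
       (use f' g' in blast)+
qed

lemmas Ck_on_scaleR = bounded_bilinear.Ck_on[OF bounded_bilinear_scaleR]
lemmas Ck_on_inner = bounded_bilinear.Ck_on[OF bounded_bilinear_inner]
lemmas Ck_on_mult = bounded_bilinear.Ck_on[OF bounded_bilinear_mult]

lemma Ck_on_sum:
  "(\<And>i. i \<in> A \<Longrightarrow> Ck_on k S (f i)) \<Longrightarrow> Ck_on k S (\<lambda>x. \<Sum>i\<in>A. f i x)"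
  by (induction A rule: infinite_finite_induct) (auto intro: Ck_on_const Ck_on_add)

text \<open>The derivative of the outer map is applied to a variable vector; expanding that vector in
  the standard basis turns the chain rule into a finite sum of products.\<close>

lemma Ck_on_compose:
  fixes f :: "'a::euclidean_space \<Rightarrow> 'b::euclidean_space" and g :: "'b \<Rightarrow> 'c::real_normed_vector"
  assumes "Ck_on k S f" "Ck_on k R g" "f ` S \<subseteq> R"
  shows "Ck_on k S (\<lambda>x. g (f x))"
  using assms
proof (induction k arbitrary: g)
  case 0
  then show ?case using continuous_on_compose2[of R g S f] by simp
next
  case (Suc k)
  from Suc.prems(1) obtain f' where "\<forall>x\<in>S. (f has_derivative f' x) (at x within S)"
      "\<forall>v. Ck_on k S (\<lambda>x. f' x v)" by auto
  then have f': "\<And>x. x\<in>S \<Longrightarrow> (f has_derivative f' x) (at x within S)"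
      "\<And>v. Ck_on k S (\<lambda>x. f' x v)" by blast+
  from Suc.prems(2) obtain g' where "\<forall>x\<in>R. (g has_derivative g' x) (at x within R)"
      "\<forall>v. Ck_on k R (\<lambda>x. g' x v)" by auto
  then have g': "\<And>x. x\<in>R \<Longrightarrow> (g has_derivative g' x) (at x within R)"
      "\<And>v. Ck_on k R (\<lambda>x. g' x v)" by blast+
  have chain: "((\<lambda>x. g (f x)) has_derivative (\<lambda>v. g' (f x) (f' x v))) (at x within S)" if "x \<in> S" for x
    by (rule has_derivative_in_compose[OF f'(1)[OF that]])
       (use g'(1)[of "f x"] Suc.prems(3) that has_derivative_subset in blast)
  have expand: "g' (f x) (f' x v) = (\<Sum>b\<in>Basis. (f' x v \<bullet> b) *\<^sub>R g' (f x) b)" if "x \<in> S" for x v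
  proof -
    have lin: "linear (g' (f x))"
      using g'(1)[of "f x"] Suc.prems(3) that has_derivative_linear by blast
    have "g' (f x) (f' x v) = g' (f x) (\<Sum>b\<in>Basis. (f' x v \<bullet> b) *\<^sub>R b)"
      by (simp add: euclidean_representation)
    then show ?thesis by (simp add: linear_sum[OF lin] linear_scale[OF lin])
  qed
  have "Ck_on k S (\<lambda>x. \<Sum>b\<in>Basis. (f' x v \<bullet> b) *\<^sub>R g' (f x) b)" for v
    by (intro Ck_on_sum Ck_on_scaleR Ck_on_inner Ck_on_const f'(2)
          Suc.IH[OF Ck_on_SucD[OF Suc.prems(1)] g'(2) Suc.prems(3)])
  then have "Ck_on k S (\<lambda>x. g' (f x) (f' x v))" for v
    by (rule Ck_on_cong[THEN iffD2, rotated]) (rule expand)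
  with chain show ?case
    unfolding Ck_on.simps by (intro exI[of _ "\<lambda>x v. g' (f x) (f' x v)"]) blast
qed

lemma Ck_on_Pair:
  fixes f :: "'a::euclidean_space \<Rightarrow> 'b::real_normed_vector" and g :: "'a \<Rightarrow> 'c::real_normed_vector"
  assumes "Ck_on k S f" "Ck_on k S g"
  shows "Ck_on k S (\<lambda>x. (f x, g x))"
  using assms
proof (induction k arbitrary: f g)
  case 0
  then show ?case by (auto intro: continuous_on_Pair)
next
  case (Suc k)
  from Suc.prems obtain f' where f': "\<forall>x\<in>S. (f has_derivative f' x) (at x within S)"
      "\<forall>v. Ck_on k S (\<lambda>x. f' x v)" by auto
  from Suc.prems obtain g' where g': "\<forall>x\<in>S. (g has_derivative g' x) (at x within S)"
      "\<forall>v. Ck_on k S (\<lambda>x. g' x v)" by auto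
  show ?case
    unfolding Ck_on.simps
    by (intro exI[of _ "\<lambda>x v. (f' x v, g' x v)"] conjI ballI allI has_derivative_Pair Suc.IH)
       (use f' g' in blast)+
qed

lemma smooth_on_subset: "smooth_on S f \<Longrightarrow> R \<subseteq> S \<Longrightarrow> smooth_on R f"
  by (auto simp: smooth_on_def intro: Ck_on_subset)

lemma smooth_on_continuous: "smooth_on S f \<Longrightarrow> continuous_on S f"
  unfolding smooth_on_def by (metis Ck_on.simps(1))

lemma smooth_on_const: "smooth_on S (\<lambda>x. c)"
  by (simp add: smooth_on_def Ck_on_const)

lemma smooth_on_linear: "bounded_linear f \<Longrightarrow> smooth_on S f"
  by (simp add: smooth_on_def Ck_on_linear)

lemma smooth_on_id: "smooth_on S (\<lambda>x. x)"
  by (simp add: smooth_on_linear bounded_linear_ident)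

lemma smooth_on_fst: "smooth_on S (fst :: 'a::euclidean_space \<times> 'b::euclidean_space \<Rightarrow> 'a)"
  by (simp add: smooth_on_linear bounded_linear_fst)

lemma smooth_on_snd: "smooth_on S (snd :: 'a::euclidean_space \<times> 'b::euclidean_space \<Rightarrow> 'b)"
  by (simp add: smooth_on_linear bounded_linear_snd)

lemma smooth_on_add: "smooth_on S f \<Longrightarrow> smooth_on S g \<Longrightarrow> smooth_on S (\<lambda>x. f x + g x)"
  by (simp add: smooth_on_def Ck_on_add)

lemma smooth_on_scaleR: "smooth_on S f \<Longrightarrow> smooth_on S g \<Longrightarrow> smooth_on S (\<lambda>x. f x *\<^sub>R g x)"
  by (simp add: smooth_on_def Ck_on_scaleR)

lemma smooth_on_inner: "smooth_on S f \<Longrightarrow> smooth_on S g \<Longrightarrow> smooth_on S (\<lambda>x. f x \<bullet> g x)"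
  by (simp add: smooth_on_def Ck_on_inner)

lemma smooth_on_mult:
  fixes f g :: "'a::euclidean_space \<Rightarrow> real"
  shows "smooth_on S f \<Longrightarrow> smooth_on S g \<Longrightarrow> smooth_on S (\<lambda>x. f x * g x)"
  by (simp add: smooth_on_def Ck_on_mult)

lemma smooth_on_minus: "smooth_on S f \<Longrightarrow> smooth_on S (\<lambda>x. - f x)"
  using smooth_on_scaleR[OF smooth_on_const[of S "-1::real"]] by simp

lemma smooth_on_diff: "smooth_on S f \<Longrightarrow> smooth_on S g \<Longrightarrow> smooth_on S (\<lambda>x. f x - g x)"
  using smooth_on_add[OF _ smooth_on_minus] by fastforce

lemma smooth_on_compose:
  fixes f :: "'a::euclidean_space \<Rightarrow> 'b::euclidean_space"
  shows "smooth_on R g \<Longrightarrow> smooth_on S f \<Longrightarrow> f ` S \<subseteq> R \<Longrightarrow> smooth_on S (\<lambda>x. g (f x))"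
  unfolding smooth_on_def using Ck_on_compose by blast

lemma smooth_on_Pair: "smooth_on S f \<Longrightarrow> smooth_on S g \<Longrightarrow> smooth_on S (\<lambda>x. (f x, g x))"
  by (simp add: smooth_on_def Ck_on_Pair)

lemmas smooth_on_intros = smooth_on_const smooth_on_id smooth_on_fst smooth_on_snd smooth_on_add
  smooth_on_scaleR smooth_on_inner smooth_on_mult smooth_on_minus smooth_on_diff smooth_on_Pair

lemma Ck_on_Suc_real:
  fixes f :: "real \<Rightarrow> 'b::real_normed_vector"
  shows "Ck_on (Suc k) S f \<longleftrightarrow>
    (\<exists>f'. (\<forall>x\<in>S. (f has_vector_derivative f' x) (at x within S)) \<and> Ck_on k S f')"
proof
  assume "Ck_on (Suc k) S f"
  then obtain f' where f': "\<forall>x\<in>S. (f has_derivative f' x) (at x within S)"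
      "\<forall>v. Ck_on k S (\<lambda>x. f' x v)" by auto
  have "(f has_vector_derivative f' x 1) (at x within S)" if "x \<in> S" for x
  proof -
    have "linear (f' x)" using f'(1) that has_derivative_linear by blast
    then have "f' x = (\<lambda>v. v *\<^sub>R f' x 1)"
      by (metis (mono_tags, opaque_lifting) linear_scale mult.right_neutral real_scaleR_def)
    then show ?thesis using f'(1) that by (metis has_vector_derivative_def)
  qed
  then show "\<exists>f'. (\<forall>x\<in>S. (f has_vector_derivative f' x) (at x within S)) \<and> Ck_on k S f'"
    using f'(2) by (intro exI[of _ "\<lambda>x. f' x 1"]) auto
next
  assume "\<exists>f'. (\<forall>x\<in>S. (f has_vector_derivative f' x) (at x within S)) \<and> Ck_on k S f'"
  then obtain f' where "\<forall>x\<in>S. (f has_vector_derivative f' x) (at x within S)" "Ck_on k S f'" by auto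
  then show "Ck_on (Suc k) S f"
    unfolding Ck_on.simps has_vector_derivative_def
    by (intro exI[of _ "\<lambda>x v. v *\<^sub>R f' x"]) (auto intro: Ck_on_scaleR Ck_on_const)
qed

text \<open>A function is smooth if its derivative is a smooth expression in the function itself: each
  order of differentiability yields the next one.\<close>

lemma smooth_on_bootstrap:
  assumes "continuous_on S f"
    and "\<And>k. Ck_on k S f \<Longrightarrow> Ck_on (Suc k) S f"
  shows "smooth_on S f"
  unfolding smooth_on_def
proof
  show "Ck_on k S f" for k by (induction k) (use assms in auto)
qed

lemma smooth_on_exp: "smooth_on S (exp :: real \<Rightarrow> real)"
proof (rule smooth_on_bootstrap)
  show "continuous_on S (exp :: real \<Rightarrow> real)"
    by (intro continuous_intros)
  have "(exp has_vector_derivative exp x) (at x within S)" for x :: real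
    unfolding has_real_derivative_iff_has_vector_derivative[symmetric]
    by (rule DERIV_exp[THEN DERIV_subset]) simp
  then show "Ck_on k S exp \<Longrightarrow> Ck_on (Suc k) S (exp :: real \<Rightarrow> real)" for k
    unfolding Ck_on_Suc_real by blast
qed

lemma smooth_on_inverse_sqrt: "smooth_on {0<..} (\<lambda>u::real. inverse (sqrt u))"
proof (rule smooth_on_bootstrap)
  show "continuous_on {0<..} (\<lambda>u::real. inverse (sqrt u))"
    by (auto intro!: continuous_intros)
  fix k assume k: "Ck_on k {0<..} (\<lambda>u::real. inverse (sqrt u))"
  let ?r = "\<lambda>u::real. inverse (sqrt u)"
  have "(?r has_vector_derivative - (1/2) * (?r u * (?r u * ?r u))) (at u within {0<..})"
    if "u > 0" for u
    unfolding has_real_derivative_iff_has_vector_derivative[symmetric]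
    using that by (auto intro!: derivative_eq_intros simp: field_simps power2_eq_square)
  moreover have "Ck_on k {0<..} (\<lambda>u. - (1/2) * (?r u * (?r u * ?r u)))"
    by (intro Ck_on_mult Ck_on_const k)
  ultimately show "Ck_on (Suc k) {0<..} ?r"
    unfolding Ck_on_Suc_real
    by (intro exI[of _ "\<lambda>u. - (1/2) * (?r u * (?r u * ?r u))"]) auto
qed

lemma smooth_on_inverse_norm:
  fixes f :: "'a::euclidean_space \<Rightarrow> 'b::euclidean_space"
  assumes "smooth_on S f" "\<And>x. x \<in> S \<Longrightarrow> f x \<noteq> 0"
  shows "smooth_on S (\<lambda>x. 1 / norm (f x))"
proof -
  have "smooth_on S (\<lambda>x. inverse (sqrt (f x \<bullet> f x)))"
    using assms
    by (intro smooth_on_compose[OF smooth_on_inverse_sqrt] smooth_on_intros) auto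
  then show ?thesis by (simp add: norm_eq_sqrt_inner inverse_eq_divide)
qed

lemma smooth_on_divide_pos:
  fixes f g :: "'a::euclidean_space \<Rightarrow> real"
  assumes "smooth_on S f" "smooth_on S g" "\<And>x. x \<in> S \<Longrightarrow> g x > 0"
  shows "smooth_on S (\<lambda>x. f x / g x)"
proof -
  have "smooth_on S (\<lambda>x. f x * (1 / norm (g x)))"
    using assms by (intro smooth_on_intros smooth_on_inverse_norm) force+
  then show ?thesis
    by (rule smooth_on_cong[THEN iffD1, rotated]) (simp add: assms(3) abs_of_pos)
qed

text \<open>Continuity of one partial derivative makes the increments along segments of \<open>J\<close> uniform, which
  upgrades the two partial derivatives to a total one; hence the convexity of \<open>J\<close>.\<close>

lemma Ck_on_SucI_partials:
  fixes F :: "real \<times> real \<Rightarrow> 'b::euclidean_space"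
  assumes t: "\<And>t x. t \<in> I \<Longrightarrow> x \<in> J \<Longrightarrow> ((\<lambda>t. F (t, x)) has_vector_derivative A (t, x)) (at t within I)"
    and x: "\<And>t x. t \<in> I \<Longrightarrow> x \<in> J \<Longrightarrow> ((\<lambda>x. F (t, x)) has_vector_derivative B (t, x)) (at x within J)"
    and "Ck_on k (I \<times> J) A" "Ck_on k (I \<times> J) B" "convex J"
  shows "Ck_on (Suc k) (I \<times> J) F"
proof -
  have contB: "continuous_on (I \<times> J) B"
    using Ck_on_le[OF _ assms(4), of 0] by simp
  have "(F has_derivative (\<lambda>(h, l). h *\<^sub>R A (t, x) + l *\<^sub>R B (t, x))) (at (t, x) within I \<times> J)"
    if "t \<in> I" "x \<in> J" for t x
  proof -
    have "((\<lambda>(t, x). F (t, x)) has_derivative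
        (\<lambda>(h, l). h *\<^sub>R A (t, x) + blinfun_apply (blinfun_scaleR_left (B (t, x))) l))
        (at (t, x) within I \<times> J)"
    proof (rule has_derivative_partialsI, goal_cases)
      case 1
      show ?case using t that by (simp add: has_vector_derivative_def)
    next
      case (2 t x)
      then show ?case using x by (simp add: has_vector_derivative_def)
    next
      case 3
      have "continuous (at (t, x) within I \<times> J) (\<lambda>z. blinfun_scaleR_left (B z))"
        using contB that
        by (intro bounded_linear.continuous[OF bounded_linear_blinfun_scaleR_left])
           (auto simp: continuous_on_eq_continuous_within)
      then show ?case by (simp add: continuous_within case_prod_beta')
    qed (use that assms in auto)
    then show ?thesis by (simp add: case_prod_beta')
  qed
  then have "\<forall>z\<in>I \<times> J. (F has_derivative (\<lambda>h. fst h *\<^sub>R A z + snd h *\<^sub>R B z)) (at z within I \<times> J)"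
    by (auto simp: case_prod_beta')
  moreover have "Ck_on k (I \<times> J) (\<lambda>z. fst h *\<^sub>R A z + snd h *\<^sub>R B z)" for h :: "real \<times> real"
    using assms by (intro Ck_on_add Ck_on_scaleR Ck_on_const)
  ultimately show ?thesis
    unfolding Ck_on.simps by (intro exI[of _ "\<lambda>z h. fst h *\<^sub>R A z + snd h *\<^sub>R B z"]) auto
qed

text \<open>The derivative in the definition of \<open>Ck_on\<close> is only known to exist; its values on the two unit
  vectors are named here, so that differentiability of every order becomes a statement about the two
  partial derivatives.\<close>

lemma Ck_on_SucD_partials:
  fixes F :: "real \<times> real \<Rightarrow> 'b::euclidean_space"
  assumes "Ck_on (Suc k) (I \<times> J) F"
  obtains A B where
    "\<And>t x. t \<in> I \<Longrightarrow> x \<in> J \<Longrightarrow>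
      (F has_derivative (\<lambda>(h, l). h *\<^sub>R A (t, x) + l *\<^sub>R B (t, x))) (at (t, x) within I \<times> J)"
    "\<And>t x. t \<in> I \<Longrightarrow> x \<in> J \<Longrightarrow> ((\<lambda>t. F (t, x)) has_vector_derivative A (t, x)) (at t within I)"
    "\<And>t x. t \<in> I \<Longrightarrow> x \<in> J \<Longrightarrow> ((\<lambda>x. F (t, x)) has_vector_derivative B (t, x)) (at x within J)"
    "Ck_on k (I \<times> J) A" "Ck_on k (I \<times> J) B"
proof -
  from assms obtain F' where F': "\<forall>x\<in>I\<times>J. (F has_derivative F' x) (at x within I\<times>J)"
      "\<forall>v. Ck_on k (I\<times>J) (\<lambda>x. F' x v)" by auto
  define A where "A = (\<lambda>z. F' z (1, 0))"
  define B where "B = (\<lambda>z. F' z (0, 1))"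
  have eq: "F' z = (\<lambda>(h, l). h *\<^sub>R A z + l *\<^sub>R B z)" if "z \<in> I \<times> J" for z
  proof
    fix v :: "real \<times> real"
    have lin: "linear (F' z)" using F'(1) that has_derivative_linear by blast
    have "v = fst v *\<^sub>R (1, 0) + snd v *\<^sub>R (0, 1)" by simp
    then have "F' z v = fst v *\<^sub>R F' z (1, 0) + snd v *\<^sub>R F' z (0, 1)"
      by (metis linear_add[OF lin] linear_scale[OF lin])
    then show "F' z v = (case v of (h, l) \<Rightarrow> h *\<^sub>R A z + l *\<^sub>R B z)"
      by (simp add: A_def B_def case_prod_beta')
  qed
  have D: "(F has_derivative (\<lambda>(h, l). h *\<^sub>R A (t, x) + l *\<^sub>R B (t, x))) (at (t, x) within I \<times> J)"
    if "t \<in> I" "x \<in> J" for t x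
  proof -
    have "(F has_derivative F' (t, x)) (at (t, x) within I \<times> J)"
      using F'(1) that by simp
    then show ?thesis using eq[of "(t, x)"] that by simp
  qed
  have t: "((\<lambda>t. F (t, x)) has_vector_derivative A (t, x)) (at t within I)" if "t \<in> I" "x \<in> J" for t x
  proof -
    have "((\<lambda>t. F (t, x)) has_derivative (\<lambda>h. (\<lambda>(h, l). h *\<^sub>R A (t, x) + l *\<^sub>R B (t, x)) (h, 0))) (at t within I)"
      by (rule has_derivative_in_compose[where f="\<lambda>t. (t, x)", OF _ has_derivative_subset[OF D[OF that]]])
         (use that in \<open>auto intro!: derivative_eq_intros\<close>)
    then show ?thesis by (simp add: has_vector_derivative_def)
  qed
  have x: "((\<lambda>x. F (t, x)) has_vector_derivative B (t, x)) (at x within J)" if "t \<in> I" "x \<in> J" for t x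
  proof -
    have "((\<lambda>x. F (t, x)) has_derivative (\<lambda>h. (\<lambda>(h, l). h *\<^sub>R A (t, x) + l *\<^sub>R B (t, x)) (0, h))) (at x within J)"
      by (rule has_derivative_in_compose[where f="\<lambda>x. (t, x)", OF _ has_derivative_subset[OF D[OF that]]])
         (use that in \<open>auto intro!: derivative_eq_intros\<close>)
    then show ?thesis by (simp add: has_vector_derivative_def)
  qed
  have "Ck_on k (I \<times> J) A" "Ck_on k (I \<times> J) B"
    unfolding A_def B_def by (rule F'(2)[rule_format])+
  with D t x show ?thesis by (rule that)
qed

section \<open>Derivatives in space and time of families of curves\<close>

lemma dx_eqI:
  assumes "(f has_vector_derivative f') (at x within {-1..1})" "x \<in> {-1..1}"
  shows "dx f x = f'"
  unfolding dx_def by (rule vector_derivative_within_cbox[of "-1" 1, unfolded cbox_interval, rotated -1, OF assms(1)])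
    (use assms in auto)

lemma dx_cong:
  assumes "\<And>y. y \<in> {-1..1} \<Longrightarrow> f y = g y" "x \<in> {-1..1}"
  shows "dx f x = dx g x"
proof -
  have "(f has_vector_derivative d) (at x within {-1..1}) \<longleftrightarrow>
      (g has_vector_derivative d) (at x within {-1..1})" for d
    using assms by (intro has_vector_derivative_cong_ev) (auto simp: eventually_at_filter)
  then show ?thesis by (simp add: dx_def vector_derivative_def)
qed

lemma smooth_on_has_dx:
  assumes "smooth_on {-1..1} f" "x \<in> {-1..1}"
  shows "(f has_vector_derivative dx f x) (at x within {-1..1})"
proof -
  have "Ck_on (Suc 0) {-1..1} f" using assms(1) unfolding smooth_on_def by blast
  then obtain f' where "(f has_vector_derivative f' x) (at x within {-1..1})"
    using assms(2) unfolding Ck_on_Suc_real by blast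
  then show ?thesis using dx_eqI[OF _ assms(2)] by metis
qed

lemma smooth_on_dx:
  assumes "smooth_on {-1..1} f"
  shows "smooth_on {-1..1} (dx f)"
  unfolding smooth_on_def
proof
  fix k
  have "Ck_on (Suc k) {-1..1} f" using assms unfolding smooth_on_def by blast
  then obtain f' where f': "\<forall>x\<in>{-1..1}. (f has_vector_derivative f' x) (at x within {-1..1})"
      "Ck_on k {-1..1} f'"
    unfolding Ck_on_Suc_real by blast
  have "dx f x = f' x" if "x \<in> {-1..1}" for x using f'(1) dx_eqI that by blast
  then show "Ck_on k {-1..1} (dx f)" using Ck_on_cong[of "{-1..1}" "dx f" f'] f'(2) by blast
qed

lemma smooth_family_has_dx:
  fixes F :: "real \<times> real \<Rightarrow> 'b::euclidean_space"
  assumes "smooth_on (I \<times> {-1..1}) F" "t \<in> I" "x \<in> {-1..1}"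
  shows "((\<lambda>x. F (t, x)) has_vector_derivative dx (\<lambda>x. F (t, x)) x) (at x within {-1..1})"
proof (rule smooth_on_has_dx[OF _ assms(3)])
  show "smooth_on {-1..1} (\<lambda>x. F (t, x))"
    by (rule smooth_on_compose[OF assms(1)]) (use assms in \<open>auto intro!: smooth_on_intros\<close>)
qed

text \<open>The witness for the space derivative may depend on the order \<open>k\<close>, but derivatives within \<open>[-1,1]\<close>
  are unique, so one function \<open>dx F\<close> serves for all orders.\<close>

lemma smooth_family_dx:
  fixes F :: "real \<times> real \<Rightarrow> 'b::euclidean_space"
  assumes "smooth_on (I \<times> {-1..1}) F"
  shows "smooth_on (I \<times> {-1..1}) (\<lambda>z. dx (\<lambda>x. F (fst z, x)) (snd z))"
  unfolding smooth_on_def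
proof
  fix k
  have "Ck_on (Suc k) (I \<times> {-1..1}) F" using assms unfolding smooth_on_def by blast
  from Ck_on_SucD_partials[OF this] obtain B where
    "\<And>t x. t \<in> I \<Longrightarrow> x \<in> {-1..1} \<Longrightarrow>
        ((\<lambda>x. F (t, x)) has_vector_derivative B (t, x)) (at x within {-1..1})"
    and B: "Ck_on k (I \<times> {-1..1}) B" by metis
  then have "dx (\<lambda>x. F (fst z, x)) (snd z) = B z" if "z \<in> I \<times> {-1..1}" for z
    using that by (cases z) (auto intro!: dx_eqI)
  then show "Ck_on k (I \<times> {-1..1}) (\<lambda>z. dx (\<lambda>x. F (fst z, x)) (snd z))"
    using Ck_on_cong[of "I \<times> {-1..1}" "\<lambda>z. dx (\<lambda>x. F (fst z, x)) (snd z)" B] B by blast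
qed

lemma smooth_family_has_dt:
  fixes F :: "real \<times> real \<Rightarrow> 'b::euclidean_space"
  assumes "smooth_on ({0<..<T} \<times> J) F" "t \<in> {0<..<T}" "x \<in> J"
  shows "((\<lambda>t. F (t, x)) has_vector_derivative dt (\<lambda>t x. F (t, x)) t x) (at t)"
proof -
  have "Ck_on (Suc 0) ({0<..<T} \<times> J) F" using assms unfolding smooth_on_def by blast
  from Ck_on_SucD_partials[OF this] obtain A where
    "\<And>t x. t \<in> {0<..<T} \<Longrightarrow> x \<in> J \<Longrightarrow>
        ((\<lambda>t. F (t, x)) has_vector_derivative A (t, x)) (at t within {0<..<T})" by metis
  then have "((\<lambda>t. F (t, x)) has_vector_derivative A (t, x)) (at t)"
    using assms at_within_open[of t "{0<..<T}"] by fastforce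
  then show ?thesis by (simp add: dt_def vector_derivative_at)
qed

lemma smooth_family_dt:
  fixes F :: "real \<times> real \<Rightarrow> 'b::euclidean_space"
  assumes "smooth_on ({0<..<T} \<times> J) F"
  shows "smooth_on ({0<..<T} \<times> J) (\<lambda>z. dt (\<lambda>t x. F (t, x)) (fst z) (snd z))"
  unfolding smooth_on_def
proof
  fix k
  have "Ck_on (Suc k) ({0<..<T} \<times> J) F" using assms unfolding smooth_on_def by blast
  from Ck_on_SucD_partials[OF this] obtain A where A:
    "\<And>t x. t \<in> {0<..<T} \<Longrightarrow> x \<in> J \<Longrightarrow>
        ((\<lambda>t. F (t, x)) has_vector_derivative A (t, x)) (at t within {0<..<T})"
    "Ck_on k ({0<..<T} \<times> J) A" by metis
  have "dt (\<lambda>t x. F (t, x)) (fst z) (snd z) = A z" if "z \<in> {0<..<T} \<times> J" for z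
  proof -
    have "((\<lambda>t. F (t, snd z)) has_vector_derivative A z) (at (fst z))"
      using A(1)[of "fst z" "snd z"] that at_within_open[of "fst z" "{0<..<T}"]
      by (auto simp: mem_Times_iff)
    then show ?thesis by (simp add: dt_def vector_derivative_at)
  qed
  then show "Ck_on k ({0<..<T} \<times> J) (\<lambda>z. dt (\<lambda>t x. F (t, x)) (fst z) (snd z))"
    using Ck_on_cong[of "{0<..<T} \<times> J" "\<lambda>z. dt (\<lambda>t x. F (t, x)) (fst z) (snd z)" A] A(2) by blast
qed

section \<open>Smooth cutoff functions\<close>

text \<open>These functions are closed under differentiation up to linear combinations, which makes the
  smoothness of \<open>exp (-1/u)\<close> at the origin an induction over all of them at once.\<close>

definition flat_power :: "nat \<Rightarrow> real \<Rightarrow> real" where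
  "flat_power n u = (if u > 0 then (1 / u) ^ n * exp (- (1 / u)) else 0)"

lemma flat_power_tendsto_0: "(flat_power n \<longlongrightarrow> 0) (at 0)"
proof (rule filterlim_split_at)
  have "((\<lambda>u. (inverse u) ^ n / exp (inverse u)) \<longlongrightarrow> 0) (at_right (0::real))"
    by (rule filterlim_compose[OF tendsto_power_div_exp_0 filterlim_inverse_at_top_right])
  moreover have "eventually (\<lambda>u. (inverse u) ^ n / exp (inverse u) = flat_power n u) (at_right 0)"
    unfolding eventually_at_filter flat_power_def
    by (auto simp: exp_minus field_simps)
  ultimately show "(flat_power n \<longlongrightarrow> 0) (at_right 0)"
    by (rule Lim_transform_eventually)
  have "eventually (\<lambda>u. 0 = flat_power n u) (at_left 0)"
    unfolding eventually_at_filter flat_power_def by auto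
  then show "(flat_power n \<longlongrightarrow> 0) (at_left 0)"
    by (rule Lim_transform_eventually[OF tendsto_const])
qed

lemma flat_power_has_derivative:
  "(flat_power n has_real_derivative flat_power (n + 2) u - real n * flat_power (n + 1) u) (at u)"
proof (cases u "0::real" rule: linorder_cases)
  case less
  have "((\<lambda>u. 0) has_real_derivative flat_power (n + 2) u - real n * flat_power (n + 1) u) (at u)"
    using less by (simp add: flat_power_def)
  then show ?thesis
    by (rule has_field_derivative_transform_within_open[of _ _ _ "{..<0}"])
       (use less in \<open>auto simp: flat_power_def\<close>)
next
  case equal
  have "eventually (\<lambda>h. flat_power (n + 1) h = (flat_power n (0 + h) - flat_power n 0) / h) (at 0)"
    unfolding eventually_at_filter flat_power_def by (auto simp: field_simps)
  then have "((\<lambda>h. (flat_power n (0 + h) - flat_power n 0) / h) \<longlongrightarrow> 0) (at 0)"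
    by (rule Lim_transform_eventually[OF flat_power_tendsto_0])
  then show ?thesis using equal by (simp add: DERIV_def flat_power_def)
next
  case greater
  have inv: "((\<lambda>u. 1 / u) has_real_derivative - ((1 / u)\<^sup>2)) (at u)"
    using greater by (auto intro!: derivative_eq_intros simp: power2_eq_square field_simps)
  have "((\<lambda>u. exp (- (1 / u))) has_real_derivative exp (- (1 / u)) * (- (- ((1 / u)\<^sup>2)))) (at u)"
    by (rule DERIV_chain2[OF DERIV_exp DERIV_minus[OF inv]])
  from DERIV_mult[OF DERIV_power[OF inv] this]
  have "((\<lambda>u. (1 / u) ^ n * exp (- (1 / u))) has_real_derivative
      flat_power (n + 2) u - real n * flat_power (n + 1) u) (at u)"
    by (rule DERIV_cong)
       (use greater in \<open>cases n; simp add: flat_power_def power2_eq_square algebra_simps\<close>)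
  then show ?thesis
    by (rule has_field_derivative_transform_within_open[of _ _ _ "{0<..}"])
       (use greater in \<open>auto simp: flat_power_def\<close>)
qed

lemma smooth_on_flat_power: "smooth_on UNIV (flat_power n)"
proof -
  have "Ck_on k UNIV (flat_power n)" for k
  proof (induction k arbitrary: n)
    case 0
    show ?case
      using DERIV_isCont[OF flat_power_has_derivative] by (simp add: continuous_on_eq_continuous_at)
  next
    case (Suc k)
    have "Ck_on k UNIV (\<lambda>u. flat_power (n + 2) u + (- real n) * flat_power (n + 1) u)"
      by (intro Ck_on_add Ck_on_mult Ck_on_const Suc)
    then show ?case
      unfolding Ck_on_Suc_real
      by (intro exI[of _ "\<lambda>u. flat_power (n + 2) u + (- real n) * flat_power (n + 1) u"] conjI ballI)
         (use flat_power_has_derivative in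
            \<open>simp_all add: has_real_derivative_iff_has_vector_derivative\<close>)
  qed
  then show ?thesis by (simp add: smooth_on_def)
qed

abbreviation flat :: "real \<Rightarrow> real" where "flat \<equiv> flat_power 0"

lemma flat_nonneg: "flat u \<ge> 0" and flat_pos: "u > 0 \<Longrightarrow> flat u > 0"
  and flat_zero: "u \<le> 0 \<Longrightarrow> flat u = 0"
  by (auto simp: flat_power_def)

text \<open>This is what keeps the graph of \<open>t + flat (a - t)\<close> below the level \<open>a\<close> in the next construction.\<close>

lemma flat_le: "0 < u \<Longrightarrow> flat u \<le> u"
proof -
  assume u: "0 < u"
  have "1 / u \<le> exp (1 / u)" using exp_ge_add_one_self[of "1/u"] by linarith
  then have "inverse (exp (1 / u)) \<le> inverse (1 / u)"
    using u by (intro le_imp_inverse_le) auto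
  then show ?thesis using u by (simp add: flat_power_def exp_minus)
qed

definition smooth_step :: "real \<Rightarrow> real" where
  "smooth_step u = flat u / (flat u + flat (1 - u))"

lemma smooth_step_denominator_pos: "flat u + flat (1 - u) > 0"
proof (cases "u > 0")
  case True
  then show ?thesis using flat_pos[of u] flat_nonneg[of "1 - u"] by linarith
next
  case False
  then show ?thesis using flat_nonneg[of u] flat_pos[of "1 - u"] by linarith
qed

lemma smooth_on_smooth_step: "smooth_on UNIV smooth_step"
proof -
  have "smooth_on UNIV (\<lambda>u. flat u / (flat u + flat (1 - u)))"
    by (intro smooth_on_divide_pos smooth_on_intros smooth_on_flat_power
        smooth_on_compose[OF smooth_on_flat_power]) (auto intro: smooth_step_denominator_pos)
  then show ?thesis by (simp add: smooth_step_def[abs_def])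
qed

lemma smooth_step_0: "u \<le> 0 \<Longrightarrow> smooth_step u = 0"
  and smooth_step_1: "u \<ge> 1 \<Longrightarrow> smooth_step u = 1"
  using smooth_step_denominator_pos[of u] by (auto simp: smooth_step_def flat_zero)

lemma smooth_step_bounds: "0 \<le> smooth_step u" "smooth_step u \<le> 1"
  using smooth_step_denominator_pos[of u] flat_nonneg[of u] flat_nonneg[of "1 - u"]
  by (auto simp: smooth_step_def divide_simps)

text \<open>Composition with \<open>\<theta>\<close> turns a smooth function on \<open>(0,T)\<close> into one on \<open>[0,T)\<close> that is unchanged at
  times \<open>t \<ge> a\<close>.  The perturbation \<open>flat (a - t)\<close> of the identity lifts
  \<open>0\<close> to a positive time.\<close>

lemma smooth_time_retraction:
  assumes "0 < a" "a < T"
  obtains \<theta> :: "real \<Rightarrow> real" where "smooth_on UNIV \<theta>" "\<And>t. a \<le> t \<Longrightarrow> \<theta> t = t"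
    "\<And>t. 0 \<le> t \<Longrightarrow> t < T \<Longrightarrow> 0 < \<theta> t \<and> \<theta> t < T"
proof
  define \<theta> where "\<theta> t = t + flat (a - t)" for t
  show "smooth_on UNIV \<theta>"
    unfolding \<theta>_def[abs_def]
    by (intro smooth_on_intros smooth_on_compose[OF smooth_on_flat_power]) auto
  show "\<theta> t = t" if "a \<le> t" for t using that by (simp add: \<theta>_def flat_zero)
  show "0 < \<theta> t \<and> \<theta> t < T" if "0 \<le> t" "t < T" for t
  proof (cases "t < a")
    case True
    then show ?thesis using flat_pos[of "a - t"] flat_le[of "a - t"] assms that by (simp add: \<theta>_def)
  next
    case False
    then show ?thesis using assms that by (simp add: \<theta>_def flat_zero)
  qed
qed

section \<open>The flow of a vector field on a compact interval\<close>

lemma at_within_restrict_time: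
  fixes t c T :: real
  assumes "t < c" "c \<le> T"
  shows "at t within {0..<T} = at t within {0..c}"
    "at (t, x) within {0..<T} \<times> J = at (t, x :: real) within {0..c} \<times> J"
proof -
  show "at t within {0..<T} = at t within {0..c}"
    by (rule at_within_nhd[where S="{..<c}"]) (use assms in auto)
  show "at (t, x) within {0..<T} \<times> J = at (t, x) within {0..c} \<times> J"
    by (rule at_within_nhd[where S="{..<c} \<times> UNIV"]) (use assms in \<open>auto intro!: open_Times\<close>)
qed

lemma integral_has_vector_derivative_half_open:
  fixes f :: "real \<Rightarrow> 'b::banach"
  assumes "continuous_on {0..<T} f" "0 \<le> t" "t < T"
  shows "((\<lambda>t. integral {0..t} f) has_vector_derivative f t) (at t within {0..<T})"
proof -
  define c where "c = (t + T) / 2"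
  have "((\<lambda>t. integral {0..t} f) has_vector_derivative f t) (at t within {0..c})"
    using assms by (intro integral_has_vector_derivative continuous_on_subset[OF assms(1)]) (auto simp: c_def)
  then show ?thesis
    using at_within_restrict_time(1)[of t c T] assms by (simp add: c_def)
qed

text \<open>The substitution \<open>s = t r\<close> makes the domain of integration constant, so that continuity of
  parameter integrals applies.\<close>

lemma continuous_on_integral_upto:
  fixes F :: "real \<times> 'p::topological_space \<Rightarrow> real"
  assumes "continuous_on ({0..<T} \<times> J) F"
  shows "continuous_on ({0..<T} \<times> J) (\<lambda>(t, x). integral {0..t} (\<lambda>s. F (s, x)))"
proof -
  have "continuous_on (({0..<T} \<times> J) \<times> cbox 0 1) (\<lambda>(z, r). F (fst z * r, snd z))"
    unfolding case_prod_beta'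
  proof (rule continuous_on_compose2[OF assms])
    show "(\<lambda>x. (fst (fst x) * snd x, snd (fst x))) ` (({0..<T} \<times> J) \<times> cbox 0 1) \<subseteq> {0..<T} \<times> J"
    proof (clarsimp simp: mem_Times_iff)
      fix t r :: real assume "0 \<le> t" "t < T" "0 \<le> r" "r \<le> 1"
      then show "t * r < T"
        using mult_left_le[of r t] by simp
    qed
  qed (intro continuous_intros)
  then have "continuous_on ({0..<T} \<times> J) (\<lambda>z. integral (cbox 0 1) (\<lambda>r. F (fst z * r, snd z)))"
    by (rule integral_continuous_on_param)
  then have "continuous_on ({0..<T} \<times> J) (\<lambda>z. fst z * integral {0..1} (\<lambda>r. F (fst z * r, snd z)))"
    by (intro continuous_intros) simp
  moreover have "t * integral {0..1} (\<lambda>r. F (t * r, x)) = integral {0..t} (\<lambda>s. F (s, x))"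
    if "t \<in> {0..<T}" "x \<in> J" for t x
  proof (cases "t = 0")
    case False
    have "continuous_on {0..t} (\<lambda>s. F (s, x))"
      by (rule continuous_on_compose2[OF assms]) (use that in \<open>auto intro!: continuous_intros\<close>)
    then have "((\<lambda>s. F (s, x)) has_integral integral {0..t} (\<lambda>s. F (s, x))) {0..t}"
      using integrable_continuous_real integrable_integral by blast
    from has_integral_stretch_real[OF this False]
    have "((\<lambda>r. F (t * r, x)) has_integral (1 / t) * integral {0..t} (\<lambda>s. F (s, x))) {0..1}"
      using False that by (simp add: image_divide_atLeastAtMost)
    then show ?thesis using False by (simp add: has_integral_iff)
  qed simp
  ultimately show ?thesis
    by (auto intro: continuous_on_eq)
qed

text \<open>Successive Picard iterates differ by at most \<open>K L\<^sup>n t\<^sup>n\<^sup>+\<^sup>1 / (n+1)!\<close>, where \<open>K\<close> and \<open>L\<close> depend on the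
  compact time interval only.  Hence a single sequence converges on all of \<open>[0,T)\<close>, locally uniformly
  in time and uniformly in the initial value, and no gluing of local solutions is needed.  Zeros of
  the field are fixed by every iterate, hence by the limit.\<close>

theorem flow_exists_Lipschitz:
  fixes B :: "real \<times> real \<Rightarrow> real"
  assumes contB: "continuous_on ({0..<T} \<times> UNIV) B"
    and bound: "\<And>c. 0 \<le> c \<Longrightarrow> c < T \<Longrightarrow> \<exists>K. \<forall>s\<in>{0..c}. \<forall>u. \<bar>B (s, u)\<bar> \<le> K"
    and Lip: "\<And>c. 0 \<le> c \<Longrightarrow> c < T \<Longrightarrow> \<exists>L. \<forall>s\<in>{0..c}. \<forall>u v. \<bar>B (s, u) - B (s, v)\<bar> \<le> L * \<bar>u - v\<bar>"
  obtains u where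
    "continuous_on ({0..<T} \<times> UNIV) u"
    "\<And>t x. 0 \<le> t \<Longrightarrow> t < T \<Longrightarrow> u (t, x) = x + integral {0..t} (\<lambda>s. B (s, u (s, x)))"
    "\<And>t x. (\<And>s. 0 \<le> s \<Longrightarrow> s < T \<Longrightarrow> B (s, x) = 0) \<Longrightarrow> 0 \<le> t \<Longrightarrow> t < T \<Longrightarrow> u (t, x) = x"
proof -
  define P where "P = rec_nat (\<lambda>z. snd z)
    (\<lambda>_ p z. snd z + integral {0..fst z} (\<lambda>s. B (s, p (s, snd z :: real))))"
  have P0: "P 0 z = snd z" for z by (simp add: P_def)
  have PS: "P (Suc n) z = snd z + integral {0..fst z} (\<lambda>s. B (s, P n (s, snd z)))" for n z
    by (simp add: P_def)
  define D where "D = {0..<T} \<times> (UNIV :: real set)"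
  have contP: "continuous_on D (P n)" for n
  proof (induction n)
    case 0
    show ?case unfolding P0[abs_def] by (intro continuous_intros)
  next
    case (Suc n)
    have "continuous_on D (\<lambda>z. B (fst z, P n z))"
      by (rule continuous_on_compose2[OF contB]) (use Suc in \<open>auto simp: D_def intro!: continuous_intros\<close>)
    from continuous_on_integral_upto[OF this[unfolded D_def]]
    have "continuous_on D (\<lambda>z. snd z + integral {0..fst z} (\<lambda>s. B (s, P n (s, snd z))))"
      by (intro continuous_intros) (simp add: D_def case_prod_beta')
    then show ?case by (simp add: PS[abs_def])
  qed
  have contBP: "continuous_on {0..<T} (\<lambda>s. B (s, p (s, x)))" if "continuous_on D p" for p x
    by (rule continuous_on_compose2[OF contB])
       (auto simp: D_def intro!: continuous_intros continuous_on_compose2[OF that])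
  define u where "u z = snd z + (\<Sum>n. P (Suc n) z - P n z)" for z
  have ulim: "uniform_limit ({0..c} \<times> UNIV) P u sequentially" if c: "0 \<le> c" "c < T" for c
  proof -
    from bound[OF c] obtain K where K: "\<And>s v. s \<in> {0..c} \<Longrightarrow> \<bar>B (s, v)\<bar> \<le> K" by blast
    from Lip[OF c] obtain L' where L': "\<And>s v w. s \<in> {0..c} \<Longrightarrow> \<bar>B (s, v) - B (s, w)\<bar> \<le> L' * \<bar>v - w\<bar>"
      by blast
    define L where "L = \<bar>L'\<bar>"
    have L: "\<bar>B (s, v) - B (s, w)\<bar> \<le> L * \<bar>v - w\<bar>" if "s \<in> {0..c}" for s v w
      using L'[OF that, of v w] mult_right_mono[OF abs_ge_self[of L'], of "\<bar>v - w\<bar>"]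
      by (simp add: L_def)
    have "K \<ge> 0" using K[of 0] c by force
    have "L \<ge> 0" by (simp add: L_def)
    have intBP: "(\<lambda>s. B (s, P n (s, x))) integrable_on {0..t}" if "t \<le> c" for n t x
      using that c by (intro integrable_continuous_real continuous_on_subset[OF contBP[OF contP]]) auto
    have step: "\<bar>P (Suc n) (t, x) - P n (t, x)\<bar> \<le> K * L ^ n * (t ^ Suc n / fact (Suc n))"
      if "t \<in> {0..c}" for n t x
      using that
    proof (induction n arbitrary: t)
      case 0
      have "norm (integral {0..t} (\<lambda>s. B (s, P 0 (s, x)))) \<le> integral {0..t} (\<lambda>s. K)"
        using 0 K by (intro integral_norm_bound_integral intBP) auto
      then show ?case using 0 by (simp add: PS P0 mult.commute)
    next
      case (Suc n)
      have pow: "((\<lambda>s. K * L ^ Suc n * (s ^ Suc n / fact (Suc n))) has_integral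
          K * L ^ Suc n * (t ^ Suc (Suc n) / fact (Suc (Suc n)))) {0..t}"
      proof -
        have "((\<lambda>s. s ^ Suc (Suc n) / fact (Suc (Suc n))) has_vector_derivative s ^ Suc n / fact (Suc n))
            (at s within {0..t})" for s :: real
        proof -
          have "(fact (Suc (Suc n)) :: real) = real (Suc (Suc n)) * fact (Suc n)"
            by (simp only: fact_Suc of_nat_mult)
          then show ?thesis
            unfolding has_real_derivative_iff_has_vector_derivative[symmetric]
            by (auto intro!: derivative_eq_intros simp del: power_Suc fact_Suc)
        qed
        then have "((\<lambda>s. s ^ Suc n / fact (Suc n)) has_integral
            t ^ Suc (Suc n) / fact (Suc (Suc n)) - 0 ^ Suc (Suc n) / fact (Suc (Suc n))) {0..t}"
          using Suc.prems by (intro fundamental_theorem_of_calculus) auto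
        then show ?thesis by (intro has_integral_mult_right) simp
      qed
      have "P (Suc (Suc n)) (t, x) - P (Suc n) (t, x) =
          integral {0..t} (\<lambda>s. B (s, P (Suc n) (s, x)) - B (s, P n (s, x)))"
      proof -
        have "integral {0..t} (\<lambda>s. B (s, P (Suc n) (s, x)) - B (s, P n (s, x))) =
            integral {0..t} (\<lambda>s. B (s, P (Suc n) (s, x))) - integral {0..t} (\<lambda>s. B (s, P n (s, x)))"
          using Suc.prems by (intro integral_diff intBP) auto
        then show ?thesis by (simp only: PS[of _ "(t, x)"] fst_conv snd_conv)
      qed
      moreover have "norm (integral {0..t} (\<lambda>s. B (s, P (Suc n) (s, x)) - B (s, P n (s, x))))
          \<le> integral {0..t} (\<lambda>s. K * L ^ Suc n * (s ^ Suc n / fact (Suc n)))"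
      proof (rule integral_norm_bound_integral)
        show "(\<lambda>s. B (s, P (Suc n) (s, x)) - B (s, P n (s, x))) integrable_on {0..t}"
          using Suc.prems by (intro integrable_diff intBP) auto
        show "(\<lambda>s. K * L ^ Suc n * (s ^ Suc n / fact (Suc n))) integrable_on {0..t}"
          using pow by blast
        fix s assume s: "s \<in> {0..t}"
        then have sc: "s \<in> {0..c}" using Suc.prems by auto
        have "norm (B (s, P (Suc n) (s, x)) - B (s, P n (s, x)))
            \<le> L * \<bar>P (Suc n) (s, x) - P n (s, x)\<bar>"
          using L[OF sc] by simp
        also have "\<dots> \<le> L * (K * L ^ n * (s ^ Suc n / fact (Suc n)))"
          by (rule mult_left_mono[OF Suc.IH[OF sc] \<open>L \<ge> 0\<close>])
        finally show "norm (B (s, P (Suc n) (s, x)) - B (s, P n (s, x)))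
            \<le> K * L ^ Suc n * (s ^ Suc n / fact (Suc n))"
          by (simp add: mult_ac)
      qed
      ultimately show ?case
        using integral_unique[OF pow] by (simp only: real_norm_def)
    qed
    \<comment> \<open>A coarser bound whose series is visibly an exponential series.\<close>
    define m where "m n = K * c * ((L * c) ^ n / fact n)" for n
    have "norm (P (Suc n) z - P n z) \<le> m n" if "z \<in> {0..c} \<times> UNIV" for n z
    proof -
      obtain t x where z: "z = (t, x)" "0 \<le> t" "t \<le> c" using \<open>z \<in> _\<close> by (cases z) auto
      have "t ^ Suc n / fact (Suc n) \<le> c ^ Suc n / fact n"
        using z c by (intro frac_le power_mono fact_mono) auto
      then have "K * L ^ n * (t ^ Suc n / fact (Suc n)) \<le> K * L ^ n * (c ^ Suc n / fact n)"
        using \<open>K \<ge> 0\<close> \<open>L \<ge> 0\<close> by (intro mult_left_mono) auto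
      also have "\<dots> = m n" by (simp add: m_def power_mult_distrib)
      finally show ?thesis using step[of t n x] z by simp
    qed
    moreover have "summable m"
      using summable_exp[of "L * c"] unfolding m_def
      by (intro summable_mult) (simp add: field_simps)
    ultimately have "uniform_limit ({0..c} \<times> UNIV) (\<lambda>n z. \<Sum>i<n. P (Suc i) z - P i z)
        (\<lambda>z. \<Sum>i. P (Suc i) z - P i z) sequentially"
      by (rule Weierstrass_m_test)
    then have "uniform_limit ({0..c} \<times> UNIV) (\<lambda>n z. snd z + (\<Sum>i<n. P (Suc i) z - P i z)) u sequentially"
      unfolding u_def by (intro uniform_limit_intros)
    moreover have "snd z + (\<Sum>i<n. P (Suc i) z - P i z) = P n z" for n z
      using sum_lessThan_telescope[of "\<lambda>i. P i z" n] by (simp add: P0)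
    ultimately show ?thesis by simp
  qed
  have contu: "continuous_on D u"
    unfolding continuous_on_eq_continuous_within
  proof
    fix z assume "z \<in> D"
    then obtain t x where z: "z = (t, x)" "0 \<le> t" "t < T" by (cases z) (auto simp: D_def)
    define c where "c = (t + T) / 2"
    have c: "0 \<le> c" "c < T" "t < c" using z by (auto simp: c_def)
    have "continuous_on ({0..c} \<times> UNIV) u"
    proof (rule uniform_limit_theorem[OF _ ulim[OF c(1,2)]])
      show "\<forall>\<^sub>F n in sequentially. continuous_on ({0..c} \<times> UNIV) (P n)"
        using c by (intro always_eventually allI continuous_on_subset[OF contP]) (auto simp: D_def)
    qed simp
    then show "continuous (at z within D) u"
      using at_within_restrict_time(2)[OF c(3), of T x UNIV] c z
      by (auto simp: continuous_on_eq_continuous_within D_def)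
  qed
  have ueq: "u (t, x) = x + integral {0..t} (\<lambda>s. B (s, u (s, x)))" if t: "0 \<le> t" "t < T" for t x
  proof -
    have ul: "uniform_limit {0..t} (\<lambda>n s. B (s, P n (s, x))) (\<lambda>s. B (s, u (s, x))) sequentially"
    proof (rule uniform_limitI)
      fix e :: real assume "e > 0"
      from Lip[OF t] obtain L where L: "\<And>s v w. s \<in> {0..t} \<Longrightarrow> \<bar>B (s, v) - B (s, w)\<bar> \<le> L * \<bar>v - w\<bar>"
        by blast
      have "e / (\<bar>L\<bar> + 1) > 0" using \<open>e > 0\<close> by simp
      from uniform_limitD[OF ulim[OF t] this]
      show "\<forall>\<^sub>F n in sequentially. \<forall>s\<in>{0..t}. dist (B (s, P n (s, x))) (B (s, u (s, x))) < e"
      proof eventually_elim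
        case (elim n)
        show ?case
        proof
          fix s assume s: "s \<in> {0..t}"
          then have d: "\<bar>P n (s, x) - u (s, x)\<bar> < e / (\<bar>L\<bar> + 1)" using elim by (simp add: dist_real_def)
          have "\<bar>B (s, P n (s, x)) - B (s, u (s, x))\<bar> \<le> L * \<bar>P n (s, x) - u (s, x)\<bar>" using L[OF s] .
          also have "\<dots> \<le> (\<bar>L\<bar> + 1) * \<bar>P n (s, x) - u (s, x)\<bar>" by (intro mult_right_mono) auto
          also have "\<dots> < (\<bar>L\<bar> + 1) * (e / (\<bar>L\<bar> + 1))" by (intro mult_strict_left_mono d) auto
          finally show "dist (B (s, P n (s, x))) (B (s, u (s, x))) < e" by (simp add: dist_real_def)
        qed
      qed
    qed
    have "continuous_on {0..t} (\<lambda>s. B (s, P n (s, x)))" for n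
      using t by (intro continuous_on_subset[OF contBP[OF contP]]) auto
    from uniform_limit_integral[OF ul this]
    obtain I J where IJ: "\<And>n. ((\<lambda>s. B (s, P n (s, x))) has_integral I n) {0..t}"
      "((\<lambda>s. B (s, u (s, x))) has_integral J) {0..t}" "I \<longlonglongrightarrow> J" by auto
    have "(\<lambda>n. x + I n) \<longlonglongrightarrow> x + J" by (intro tendsto_intros IJ)
    moreover have "x + I n = P (Suc n) (t, x)" for n
      using IJ(1)[THEN integral_unique] by (simp add: PS)
    ultimately have "(\<lambda>n. P (Suc n) (t, x)) \<longlonglongrightarrow> x + J" by simp
    moreover have "(\<lambda>n. P n (t, x)) \<longlonglongrightarrow> u (t, x)"
      using tendsto_uniform_limitI[OF ulim[OF t]] t by simp
    then have "(\<lambda>n. P (Suc n) (t, x)) \<longlonglongrightarrow> u (t, x)" by (rule LIMSEQ_Suc)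
    ultimately show ?thesis using IJ(2)[THEN integral_unique] LIMSEQ_unique by blast
  qed
  have ufix: "u (t, x) = x" if x: "\<And>s. 0 \<le> s \<Longrightarrow> s < T \<Longrightarrow> B (s, x) = 0" and t: "0 \<le> t" "t < T" for t x
  proof -
    have "P n (s, x) = x" if "0 \<le> s" "s < T" for n s
      using that
    proof (induction n arbitrary: s)
      case (Suc n)
      have "integral {0..s} (\<lambda>r. B (r, P n (r, x))) = integral {0..s} (\<lambda>r. 0)"
        by (rule integral_cong) (use Suc x in auto)
      then show ?case by (simp add: PS)
    qed (simp add: P0)
    moreover have "(\<lambda>n. P n (t, x)) \<longlonglongrightarrow> u (t, x)"
      using tendsto_uniform_limitI[OF ulim[OF t]] t by simp
    ultimately have "(\<lambda>n::nat. x) \<longlonglongrightarrow> u (t, x)" using t by simp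
    then show ?thesis using LIMSEQ_unique tendsto_const by blast
  qed
  show ?thesis using that[of u] contu ueq ufix by (simp add: D_def)
qed

text \<open>The time derivative of the integral is \<open>F\<close> itself and its space derivative is the same kind of
  integral of \<open>F\<^sub>x\<close>, so each order of differentiability of \<open>F\<close> is inherited.\<close>

lemma Ck_on_integral_upto:
  fixes F :: "real \<times> real \<Rightarrow> real"
  assumes "convex J"
  shows "Ck_on k ({0..<T} \<times> J) F \<Longrightarrow>
    Ck_on k ({0..<T} \<times> J) (\<lambda>z. integral {0..fst z} (\<lambda>s. F (s, snd z)))"
proof (induction k arbitrary: F)
  case 0
  then show ?case using continuous_on_integral_upto[of T J F] by (simp add: case_prod_beta')
next
  case (Suc k)
  from Ck_on_SucD_partials[OF Suc.prems] obtain B where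
    B: "\<And>t x. t \<in> {0..<T} \<Longrightarrow> x \<in> J \<Longrightarrow> ((\<lambda>x. F (t, x)) has_vector_derivative B (t, x)) (at x within J)"
    and BC: "Ck_on k ({0..<T} \<times> J) B" by metis
  have contF: "continuous_on ({0..<T} \<times> J) F" using Ck_on_le[OF _ Suc.prems, of 0] by simp
  have contB: "continuous_on ({0..<T} \<times> J) B" using Ck_on_le[OF _ BC, of 0] by simp
  have slice: "continuous_on {0..<T} (\<lambda>s. F (s, x))" if "x \<in> J" for x
    by (rule continuous_on_compose2[OF contF]) (use that in \<open>auto intro!: continuous_intros\<close>)
  show ?case
  proof (rule Ck_on_SucI_partials[where A=F and B="\<lambda>z. integral {0..fst z} (\<lambda>s. B (s, snd z))"])
    show "((\<lambda>t. integral {0..fst (t, x)} (\<lambda>s. F (s, snd (t, x)))) has_vector_derivative F (t, x))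
        (at t within {0..<T})" if "t \<in> {0..<T}" "x \<in> J" for t x
      using integral_has_vector_derivative_half_open[OF slice[OF that(2)], of t] that by simp
    show "((\<lambda>x. integral {0..fst (t, x)} (\<lambda>s. F (s, snd (t, x)))) has_vector_derivative
        integral {0..fst (t, x)} (\<lambda>s. B (s, snd (t, x)))) (at x within J)"
      if t: "t \<in> {0..<T}" and x: "x \<in> J" for t x
      unfolding fst_conv snd_conv
    proof (rule leibniz_rule_vector_derivative[where a=0 and b=t, unfolded cbox_interval])
      show "((\<lambda>x. F (s, x)) has_vector_derivative B (s, x)) (at x within J)"
        if "x \<in> J" "s \<in> {0..t}" for x s using B that t by simp
      show "(\<lambda>s. F (s, x)) integrable_on {0..t}" if "x \<in> J" for x
        using t by (intro integrable_continuous_real continuous_on_subset[OF slice[OF that]]) auto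
      show "continuous_on (J \<times> {0..t}) (\<lambda>(x, s). B (s, x))"
        unfolding case_prod_beta'
        by (rule continuous_on_compose2[OF contB]) (use t in \<open>auto intro!: continuous_intros\<close>)
    qed (use x assms in auto)
  qed (use Suc.IH[OF BC] Ck_on_SucD[OF Suc.prems] assms in auto)
qed

text \<open>Between the last time at or below the level \<open>m\<close> and a later time above it, the mean value theorem
  would yield a time above the level with nonzero derivative.\<close>

lemma level_barrier:
  fixes v g :: "real \<Rightarrow> real"
  assumes deriv: "\<And>t. 0 \<le> t \<Longrightarrow> t < T \<Longrightarrow> (v has_vector_derivative g t) (at t within {0..<T})"
    and "v 0 \<le> m" and zero: "\<And>t. 0 \<le> t \<Longrightarrow> t < T \<Longrightarrow> v t > m \<Longrightarrow> g t = 0"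
    and "0 \<le> t" "t < T"
  shows "v t \<le> m"
proof (rule ccontr)
  assume "\<not> v t \<le> m"
  have cont: "continuous_on {0..<T} v"
    unfolding continuous_on_eq_continuous_within
    using deriv has_vector_derivative_continuous by (metis atLeastLessThan_iff)
  then have cont_t: "continuous_on {0..t} v"
    by (rule continuous_on_subset) (use assms in auto)
  define S where "S = {s \<in> {0..t}. v s \<le> m}"
  have "S = {0..t} \<inter> v -` {..m}" by (auto simp: S_def)
  then have "closed S" using continuous_closed_preimage[OF cont_t closed_atLeastAtMost closed_atMost] by simp
  moreover have "bounded S" "S \<noteq> {}" using assms by (auto simp: S_def intro: bounded_subset[of "{0..t}"])
  ultimately obtain r where r: "r \<in> S" "\<And>s. s \<in> S \<Longrightarrow> s \<le> r"
    using compact_attains_sup[of S] compact_eq_bounded_closed by metis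
  have rt: "0 \<le> r" "r < t" "v r \<le> m" using r \<open>\<not> v t \<le> m\<close> by (auto simp: S_def less_le)
  have above: "v s > m" if "r < s" "s \<le> t" for s
    using r(2)[of s] that rt by (force simp: S_def)
  have "\<exists>s\<in>{r<..<t}. v t - v r = (\<lambda>h. h *\<^sub>R g s) (t - r)"
  proof (rule mvt_simple[OF rt(2)])
    fix s assume s: "r \<le> s" "s \<le> t"
    have "(v has_vector_derivative g s) (at s within {r..t})"
      by (rule has_vector_derivative_within_subset[OF deriv]) (use s rt assms in auto)
    then show "(v has_derivative (\<lambda>h. h *\<^sub>R g s)) (at s within {r..t})"
      by (simp add: has_vector_derivative_def)
  qed
  then obtain s where s: "r < s" "s < t" "v t - v r = (t - r) * g s" by auto
  then have "g s = 0" using zero above[of s] rt assms by simp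
  then show False using s rt \<open>\<not> v t \<le> m\<close> by simp
qed

definition clamp1 :: "real \<Rightarrow> real" where "clamp1 y = max (-1) (min 1 y)"

text \<open>Existence comes from Picard iteration for the field extended constantly beyond \<open>[-1,1]\<close>; since it
  vanishes at the end points, solutions never leave the interval.
  
  In one space dimension differentiability in the initial value needs no linearised equation.  The
  difference of two solutions satisfies the scalar linear equation \<open>w' = q w\<close>, where \<open>q\<close> is the mean of
  \<open>b\<^sub>x\<close> between them, so \<open>w (t) = w (0) exp (\<integral>q)\<close>.  Dividing by \<open>w (0)\<close> and letting the initial values
  merge gives \<open>u\<^sub>x (t, x) = exp (\<integral>\<^sub>0\<^sup>t b\<^sub>x (s, u (s, x)) ds)\<close>.  Together with \<open>u\<^sub>t = b (t, u)\<close> this expresses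
  both partial derivatives smoothly through \<open>u\<close>, so \<open>u \<in> C\<^sup>k\<close> implies \<open>u \<in> C\<^sup>k\<^sup>+\<^sup>1\<close>.\<close>

theorem smooth_flow_exists:
  fixes b :: "real \<times> real \<Rightarrow> real"
  assumes T: "0 < T" and smooth: "smooth_on ({0..<T} \<times> {-1..1}) b"
    and ends: "\<And>t. 0 \<le> t \<Longrightarrow> t < T \<Longrightarrow> b (t, -1) = 0 \<and> b (t, 1) = 0"
  obtains u where
    "smooth_on ({0..<T} \<times> {-1..1}) u"
    "\<And>t x. 0 \<le> t \<Longrightarrow> t < T \<Longrightarrow> x \<in> {-1..1} \<Longrightarrow>
      ((\<lambda>t. u (t, x)) has_vector_derivative b (t, u (t, x))) (at t within {0..<T})"
    "\<And>x. u (0, x) = x"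
    "\<And>t. 0 \<le> t \<Longrightarrow> t < T \<Longrightarrow> u (t, -1) = -1 \<and> u (t, 1) = 1"
    "\<And>t x. 0 \<le> t \<Longrightarrow> t < T \<Longrightarrow> x \<in> {-1..1} \<Longrightarrow> u (t, x) \<in> {-1..1}"
    "\<And>t x. 0 \<le> t \<Longrightarrow> t < T \<Longrightarrow> x \<in> {-1..1} \<Longrightarrow> dx (\<lambda>x. u (t, x)) x > 0"
proof -
  let ?J = "{-1..1} :: real set" let ?D = "{0..<T} \<times> {-1..1} :: (real \<times> real) set"
  define bx where "bx z = dx (\<lambda>x. b (fst z, x)) (snd z)" for z
  have smooth_bx: "smooth_on ?D bx"
    unfolding bx_def[abs_def] by (rule smooth_family_dx[OF smooth])
  have bx: "((\<lambda>x. b (t, x)) has_vector_derivative bx (t, x)) (at x within ?J)"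
    if "0 \<le> t" "t < T" "x \<in> ?J" for t x
    using smooth_family_has_dx[OF smooth, of t x] that by (simp add: bx_def)
  note contb = smooth_on_continuous[OF smooth] and contbx = smooth_on_continuous[OF smooth_bx]

  define B where "B z = b (fst z, clamp1 (snd z))" for z
  have clampJ: "clamp1 y \<in> ?J" for y by (simp add: clamp1_def)
  have clamp_id: "clamp1 y = y" if "y \<in> ?J" for y using that by (simp add: clamp1_def)
  have clamp_contract: "\<bar>clamp1 v - clamp1 w\<bar> \<le> \<bar>v - w\<bar>" for v w by (auto simp: clamp1_def)
  have cont_clamp: "continuous_on UNIV clamp1"
    unfolding clamp1_def[abs_def] by (intro continuous_intros)
  have contB: "continuous_on ({0..<T} \<times> UNIV) B"
    unfolding B_def[abs_def]
    by (rule continuous_on_compose2[OF contb])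
       (use clampJ in \<open>auto intro!: continuous_intros continuous_on_compose2[OF cont_clamp]\<close>)
  have cbound: "\<exists>K. \<forall>s\<in>{0..c}. \<forall>x\<in>?J. \<bar>F (s, x)\<bar> \<le> K"
    if "continuous_on ?D F" "c < T" for F :: "real \<times> real \<Rightarrow> real" and c
  proof -
    have "compact (F ` ({0..c} \<times> ?J))"
      by (intro compact_continuous_image continuous_on_subset[OF that(1)] compact_Times)
         (use that in auto)
    then obtain K where "\<forall>y\<in>F ` ({0..c} \<times> ?J). norm y \<le> K"
      using compact_imp_bounded bounded_iff by metis
    then have "\<forall>s\<in>{0..c}. \<forall>x\<in>?J. \<bar>F (s, x)\<bar> \<le> K" by simp
    then show ?thesis by blast
  qed
  have boundB: "\<exists>K. \<forall>s\<in>{0..c}. \<forall>u. \<bar>B (s, u)\<bar> \<le> K" if "0 \<le> c" "c < T" for c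
    using cbound[OF contb that(2)] clampJ unfolding B_def by fastforce
  have LipB: "\<exists>L. \<forall>s\<in>{0..c}. \<forall>v w. \<bar>B (s, v) - B (s, w)\<bar> \<le> L * \<bar>v - w\<bar>"
    if c: "0 \<le> c" "c < T" for c
  proof -
    from cbound[OF contbx c(2)] obtain L where L: "\<And>s x. s \<in> {0..c} \<Longrightarrow> x \<in> ?J \<Longrightarrow> \<bar>bx (s, x)\<bar> \<le> L"
      by blast
    have "L \<ge> 0" using L[of 0 0] c by force
    have "\<bar>B (s, v) - B (s, w)\<bar> \<le> L * \<bar>v - w\<bar>" if s: "s \<in> {0..c}" for s v w
    proof -
      have "norm (b (s, clamp1 v) - b (s, clamp1 w)) \<le> L * norm (clamp1 v - clamp1 w)"
      proof (rule field_differentiable_bound[where S="?J" and f'="\<lambda>x. bx (s, x)"])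
        show "((\<lambda>x. b (s, x)) has_field_derivative bx (s, x)) (at x within ?J)" if "x \<in> ?J" for x
          using bx[of s x] s c that by (simp add: has_real_derivative_iff_has_vector_derivative)
      qed (use L[OF s] clampJ in auto)
      also have "\<dots> \<le> L * \<bar>v - w\<bar>"
        using clamp_contract \<open>L \<ge> 0\<close> by (simp add: mult_left_mono)
      finally show ?thesis by (simp add: B_def)
    qed
    then show ?thesis by blast
  qed
  from flow_exists_Lipschitz[OF contB boundB LipB] obtain u where
    contu: "continuous_on ({0..<T} \<times> UNIV) u" and
    ueq: "\<And>t x. 0 \<le> t \<Longrightarrow> t < T \<Longrightarrow> u (t, x) = x + integral {0..t} (\<lambda>s. B (s, u (s, x)))" and
    ufix: "\<And>t x. (\<And>s. 0 \<le> s \<Longrightarrow> s < T \<Longrightarrow> B (s, x) = 0) \<Longrightarrow> 0 \<le> t \<Longrightarrow> t < T \<Longrightarrow> u (t, x) = x"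
    by blast
  have u0: "u (0, x) = x" for x using ueq[of 0 x] T by simp
  have uends: "u (t, -1) = -1 \<and> u (t, 1) = 1" if "0 \<le> t" "t < T" for t
    using ufix[of "-1" t] ufix[of 1 t] ends that by (simp add: B_def clamp1_def)
  have uderivB: "((\<lambda>t. u (t, x)) has_vector_derivative B (t, u (t, x))) (at t within {0..<T})"
    if t: "0 \<le> t" "t < T" for t x
  proof -
    have "continuous_on {0..<T} (\<lambda>s. B (s, u (s, x)))"
      by (rule continuous_on_compose2[OF contB])
         (auto intro!: continuous_intros continuous_on_compose2[OF contu])
    from integral_has_vector_derivative_half_open[OF this t]
    have "((\<lambda>t. x + integral {0..t} (\<lambda>s. B (s, u (s, x)))) has_vector_derivative B (t, u (t, x)))
        (at t within {0..<T})"
      by (auto intro!: derivative_eq_intros)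
    then show ?thesis
      by (rule has_vector_derivative_transform[rotated 2]) (use t ueq in auto)
  qed
  have uJ: "u (t, x) \<in> ?J" if t: "0 \<le> t" "t < T" and x: "x \<in> ?J" for t x
  proof -
    have "u (t, x) \<le> 1"
      by (rule level_barrier[OF uderivB _ _ t]) (use u0 x ends in \<open>auto simp: B_def clamp1_def\<close>)
    moreover have "- u (t, x) \<le> 1"
    proof (rule level_barrier[of T _ "\<lambda>t. - B (t, u (t, x))", OF _ _ _ t])
      show "((\<lambda>t. - u (t, x)) has_vector_derivative - B (t, u (t, x))) (at t within {0..<T})"
        if "0 \<le> t" "t < T" for t
        using uderivB[OF that] by (rule has_vector_derivative_minus)
    qed (use u0 x ends in \<open>auto simp: B_def clamp1_def\<close>)
    ultimately show ?thesis by simp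
  qed
  have ut: "((\<lambda>t. u (t, x)) has_vector_derivative b (t, u (t, x))) (at t within {0..<T})"
    if "0 \<le> t" "t < T" "x \<in> ?J" for t x
    using uderivB[OF that(1,2), of x] clamp_id[OF uJ[OF that]] by (simp add: B_def)
  have contuD: "continuous_on ?D u" using contu by (rule continuous_on_subset) auto

  \<comment> \<open>The candidate for the space derivative of \<open>u\<close>.\<close>
  define E where "E z = exp (integral {0..fst z} (\<lambda>s. bx (s, u (s, snd z))))" for z
  have ux: "((\<lambda>x. u (t, x)) has_vector_derivative E (t, x)) (at x within ?J)"
    if t: "0 \<le> t" "t < T" and x: "x \<in> ?J" for t x
  proof -
    \<comment> \<open>The mean of \<open>b\<^sub>x\<close> on the segment between the solutions that start at \<open>x\<close> and at \<open>snd z\<close>.\<close>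
    define q where "q z = integral {0..1} (\<lambda>r. bx (fst z, u (fst z, x) + r * (u z - u (fst z, x))))" for z
    have segJ: "u (s, x) + r * (u (s, y) - u (s, x)) \<in> ?J"
      if "0 \<le> s" "s < T" "y \<in> ?J" "0 \<le> r" "r \<le> 1" for s y r
    proof -
      have "(1 - r) *\<^sub>R u (s, x) + r *\<^sub>R u (s, y) \<in> ?J"
        using that x by (intro convexD_alt uJ) auto
      then show ?thesis by (simp add: algebra_simps)
    qed
    have "continuous_on (?D \<times> cbox 0 1) (\<lambda>(z, r). bx (fst z, u (fst z, x) + r * (u z - u (fst z, x))))"
      unfolding case_prod_beta'
    proof (rule continuous_on_compose2[OF contbx])
      show "continuous_on (?D \<times> cbox 0 1)
          (\<lambda>p. (fst (fst p), u (fst (fst p), x) + snd p * (u (fst p) - u (fst (fst p), x))))"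
        using x by (intro continuous_intros continuous_on_compose2[OF contuD]) auto
      show "(\<lambda>p. (fst (fst p), u (fst (fst p), x) + snd p * (u (fst p) - u (fst (fst p), x)))) `
          (?D \<times> cbox 0 1) \<subseteq> ?D"
        using segJ by fastforce
    qed
    from integral_continuous_on_param[OF this]
    have contq: "continuous_on ?D q" by (simp add: q_def[abs_def])
    have bdiff: "b (s, u (s, y)) - b (s, u (s, x)) = q (s, y) * (u (s, y) - u (s, x))"
      if s: "0 \<le> s" "s < T" and y: "y \<in> ?J" for s y
    proof -
      have "b (s, u (s, x) + (u (s, y) - u (s, x))) - b (s, u (s, x)) =
          integral {0..1} (\<lambda>r. (\<lambda>h. h * bx (s, u (s, x) + r *\<^sub>R (u (s, y) - u (s, x)))) (u (s, y) - u (s, x)))"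
      proof (rule mvt_integral[where S="?J" and f="\<lambda>v. b (s, v)" and f'="\<lambda>v h. h * bx (s, v)"])
        show "((\<lambda>v. b (s, v)) has_derivative (\<lambda>h. h * bx (s, v))) (at v within ?J)" if "v \<in> ?J" for v
          using bx[OF s that] by (simp add: has_vector_derivative_def)
      qed (use segJ[OF s y] in auto)
      then show ?thesis by (simp add: q_def mult.commute)
    qed
    define Q where "Q z = integral {0..fst z} (\<lambda>s. q (s, snd z))" for z
    have contQ: "continuous_on ?D Q"
      using continuous_on_integral_upto[OF contq] by (simp add: Q_def[abs_def] case_prod_beta')
    have diff: "u (t, y) - u (t, x) = (y - x) * exp (Q (t, y))" if y: "y \<in> ?J" for y
    proof -
      have "\<exists>c. \<forall>s\<in>{0..<T}. (u (s, y) - u (s, x)) * exp (- Q (s, y)) = c"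
      proof (rule has_field_derivative_zero_constant)
        fix s assume s: "s \<in> {0..<T}"
        have "continuous_on {0..<T} (\<lambda>s. q (s, y))"
          by (rule continuous_on_compose2[OF contq]) (use y in \<open>auto intro!: continuous_intros\<close>)
        then have Qt: "((\<lambda>s. Q (s, y)) has_real_derivative q (s, y)) (at s within {0..<T})"
          using integral_has_vector_derivative_half_open[of T "\<lambda>s. q (s, y)" s] s
          by (simp add: Q_def has_real_derivative_iff_has_vector_derivative)
        have D: "((\<lambda>s. u (s, y) - u (s, x)) has_real_derivative q (s, y) * (u (s, y) - u (s, x)))
            (at s within {0..<T})"
          using has_vector_derivative_diff[OF ut[of s y] ut[of s x]] s x y bdiff[of s y]
          by (simp add: has_real_derivative_iff_has_vector_derivative)
        have "((\<lambda>s. exp (- Q (s, y))) has_real_derivative exp (- Q (s, y)) * - q (s, y)) (at s within {0..<T})"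
          by (intro DERIV_chain2[OF DERIV_exp] DERIV_minus Qt)
        from DERIV_mult[OF D this]
        show "((\<lambda>s. (u (s, y) - u (s, x)) * exp (- Q (s, y))) has_field_derivative 0) (at s within {0..<T})"
          by (rule DERIV_cong) (simp add: algebra_simps)
      qed auto
      then obtain c where c: "\<And>s. s \<in> {0..<T} \<Longrightarrow> (u (s, y) - u (s, x)) * exp (- Q (s, y)) = c" by blast
      have "(u (t, y) - u (t, x)) * exp (- Q (t, y)) = y - x"
        using c[of t] c[of 0] t T u0 by (simp add: Q_def)
      then show ?thesis by (simp add: exp_minus field_simps)
    qed
    have "continuous_on ?J (\<lambda>y. exp (Q (t, y)))"
      by (intro continuous_intros continuous_on_compose2[OF contQ]) (use t in auto)
    then have "((\<lambda>y. exp (Q (t, y))) \<longlongrightarrow> exp (Q (t, x))) (at x within ?J)"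
      using x by (simp add: continuous_on_def)
    moreover have "eventually (\<lambda>y. exp (Q (t, y)) = (u (t, y) - u (t, x)) / (y - x)) (at x within ?J)"
      unfolding eventually_at_filter using diff by (auto intro!: always_eventually)
    ultimately have "((\<lambda>y. (u (t, y) - u (t, x)) / (y - x)) \<longlongrightarrow> exp (Q (t, x))) (at x within ?J)"
      by (rule Lim_transform_eventually)
    moreover have "Q (t, x) = integral {0..t} (\<lambda>s. bx (s, u (s, x)))"
      by (simp add: Q_def q_def)
    ultimately show ?thesis
      by (simp add: E_def has_real_derivative_iff_has_vector_derivative[symmetric] has_field_derivative_iff)
  qed

  have inner: "Ck_on k ?D (\<lambda>z. (fst z, u z))" if "Ck_on k ?D u" for k
    by (rule Ck_on_Pair[OF Ck_on_linear[OF bounded_linear_fst] that])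
  have range: "(\<lambda>z. (fst z, u z)) ` ?D \<subseteq> ?D" using uJ by auto
  have smooth_u: "smooth_on ?D u"
  proof (rule smooth_on_bootstrap[OF contuD])
    fix k assume k: "Ck_on k ?D u"
    show "Ck_on (Suc k) ?D u"
    proof (rule Ck_on_SucI_partials[where A="\<lambda>z. b (fst z, u z)" and B=E])
      show "Ck_on k ?D (\<lambda>z. b (fst z, u z))"
        using Ck_on_compose[OF inner[OF k] _ range, of b] smooth by (simp add: smooth_on_def)
      have "Ck_on k ?D (\<lambda>z. bx (fst z, u z))"
        using Ck_on_compose[OF inner[OF k] _ range, of bx] smooth_bx by (simp add: smooth_on_def)
      from Ck_on_integral_upto[OF _ this]
      have "Ck_on k ?D (\<lambda>z. integral {0..fst z} (\<lambda>s. bx (s, u (s, snd z))))" by simp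
      then show "Ck_on k ?D E"
        unfolding E_def[abs_def]
        using Ck_on_compose[where g=exp and R=UNIV] smooth_on_exp[of UNIV]
        unfolding smooth_on_def by blast
    qed (use ut ux in auto)
  qed
  have "dx (\<lambda>x. u (t, x)) x > 0" if "0 \<le> t" "t < T" "x \<in> ?J" for t x
    using dx_eqI[OF ux[OF that] that(3)] by (simp add: E_def)
  then show ?thesis using that[OF smooth_u ut u0 uends uJ] by blast
qed

section \<open>Reparametrisation of curves\<close>

definition increasing_reparam :: "(real \<Rightarrow> real) \<Rightarrow> bool" where
  "increasing_reparam \<phi> \<longleftrightarrow> smooth_on {-1..1} \<phi> \<and> (\<forall>x\<in>{-1..1}. dx \<phi> x > 0) \<and> \<phi> (-1) = -1 \<and> \<phi> 1 = 1"

lemma increasing_reparam_strict_mono: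
  assumes "increasing_reparam \<phi>" "x \<in> {-1..1}" "y \<in> {-1..1}" "x < y"
  shows "\<phi> x < \<phi> y"
proof -
  have "\<exists>z\<in>{x<..<y}. \<phi> y - \<phi> x = (\<lambda>h. h *\<^sub>R dx \<phi> z) (y - x)"
  proof (rule mvt_simple[OF assms(4)])
    fix z assume z: "x \<le> z" "z \<le> y"
    then have "(\<phi> has_vector_derivative dx \<phi> z) (at z within {-1..1})"
      using assms by (intro smooth_on_has_dx) (auto simp: increasing_reparam_def)
    then have "(\<phi> has_vector_derivative dx \<phi> z) (at z within {x..y})"
      by (rule has_vector_derivative_within_subset) (use assms in auto)
    then show "(\<phi> has_derivative (\<lambda>h. h *\<^sub>R dx \<phi> z)) (at z within {x..y})"
      by (simp add: has_vector_derivative_def)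
  qed
  then obtain z where "z \<in> {x<..<y}" "\<phi> y - \<phi> x = (y - x) * dx \<phi> z" by auto
  moreover have "dx \<phi> z > 0" using assms \<open>z \<in> _\<close> by (auto simp: increasing_reparam_def)
  ultimately have "\<phi> y - \<phi> x > 0" using assms(4) by simp
  then show ?thesis by simp
qed

lemma increasing_reparam_bij_betw:
  assumes "increasing_reparam \<phi>"
  shows "bij_betw \<phi> {-1..1} {-1..1}"
  unfolding bij_betw_def
proof
  show "inj_on \<phi> {-1..1}"
    using increasing_reparam_strict_mono[OF assms] by (metis linorder_inj_onI' less_irrefl)
  have ends: "\<phi> (-1) = -1" "\<phi> 1 = 1" and smooth: "smooth_on {-1..1} \<phi>"
    using assms by (auto simp: increasing_reparam_def)
  show "\<phi> ` {-1..1} = {-1..1}"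
  proof
    have "-1 \<le> \<phi> x \<and> \<phi> x \<le> 1" if "x \<in> {-1..1}" for x
      using increasing_reparam_strict_mono[OF assms, of "-1" x]
        increasing_reparam_strict_mono[OF assms, of x 1] ends that by (cases "x = -1"; cases "x = 1") auto
    then show "\<phi> ` {-1..1} \<subseteq> {-1..1}" by auto
    show "{-1..1} \<subseteq> \<phi> ` {-1..1}"
    proof
      fix y :: real assume "y \<in> {-1..1}"
      then have "\<exists>x\<ge>-1. x \<le> 1 \<and> \<phi> x = y"
        using ends smooth_on_continuous[OF smooth] by (intro IVT') auto
      then show "y \<in> \<phi> ` {-1..1}" by auto
    qed
  qed
qed

lemma increasing_reparam_range: "increasing_reparam \<phi> \<Longrightarrow> x \<in> {-1..1} \<Longrightarrow> \<phi> x \<in> {-1..1}"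
  using increasing_reparam_bij_betw bij_betwE by blast

text \<open>The inverse \<open>g\<close> is continuous by compactness and satisfies \<open>g' = 1 / \<phi>' (g)\<close>, so its regularity
  bootstraps.\<close>

lemma smooth_on_inverse_reparam:
  assumes "increasing_reparam \<phi>"
  shows "smooth_on {-1..1} (the_inv_into {-1..1} \<phi>)"
proof (rule smooth_on_bootstrap)
  let ?J = "{-1..1} :: real set"
  let ?g = "the_inv_into ?J \<phi>"
  have bij: "bij_betw \<phi> ?J ?J" by (rule increasing_reparam_bij_betw[OF assms])
  have smooth: "smooth_on ?J \<phi>" and pos: "\<And>x. x \<in> ?J \<Longrightarrow> dx \<phi> x > 0"
    using assms by (auto simp: increasing_reparam_def)
  have g_phi: "?g (\<phi> x) = x" if "x \<in> ?J" for x
    using bij that by (simp add: bij_betw_def the_inv_into_f_f)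
  have phi_g: "\<phi> (?g y) = y" if "y \<in> ?J" for y
    using bij that by (simp add: bij_betw_def f_the_inv_into_f)
  have gJ: "?g y \<in> ?J" if "y \<in> ?J" for y
    using bij that bij_betw_the_inv_into bij_betwE by blast
  have "continuous_on (\<phi> ` ?J) ?g"
    by (rule continuous_on_inv[OF smooth_on_continuous[OF smooth]]) (use g_phi in auto)
  then show contg: "continuous_on ?J ?g" using bij by (simp add: bij_betw_def)
  have deriv: "(?g has_vector_derivative 1 / dx \<phi> (?g y)) (at y within ?J)" if y: "y \<in> ?J" for y
  proof -
    have "((\<lambda>x. (\<phi> x - \<phi> (?g y)) / (x - ?g y)) \<longlongrightarrow> dx \<phi> (?g y)) (at (?g y) within ?J)"
      using smooth_on_has_dx[OF smooth gJ[OF y]]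
      by (simp add: has_real_derivative_iff_has_vector_derivative[symmetric] has_field_derivative_iff)
    moreover have "filterlim ?g (at (?g y) within ?J) (at y within ?J)"
      unfolding filterlim_at
    proof
      show "(?g \<longlongrightarrow> ?g y) (at y within ?J)" using contg y by (simp add: continuous_on_def)
      show "eventually (\<lambda>z. ?g z \<in> ?J \<and> ?g z \<noteq> ?g y) (at y within ?J)"
        unfolding eventually_at_filter using gJ phi_g y by (intro always_eventually) metis
    qed
    ultimately have "((\<lambda>z. (\<phi> (?g z) - \<phi> (?g y)) / (?g z - ?g y)) \<longlongrightarrow> dx \<phi> (?g y)) (at y within ?J)"
      by (rule filterlim_compose)
    then have "((\<lambda>z. inverse ((\<phi> (?g z) - \<phi> (?g y)) / (?g z - ?g y))) \<longlongrightarrow> inverse (dx \<phi> (?g y)))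
        (at y within ?J)"
      by (rule tendsto_inverse) (use pos[OF gJ[OF y]] in simp)
    moreover have "eventually (\<lambda>z. inverse ((\<phi> (?g z) - \<phi> (?g y)) / (?g z - ?g y)) = (?g z - ?g y) / (z - y))
        (at y within ?J)"
      unfolding eventually_at_filter using phi_g y by (intro always_eventually) auto
    ultimately have "((\<lambda>z. (?g z - ?g y) / (z - y)) \<longlongrightarrow> inverse (dx \<phi> (?g y))) (at y within ?J)"
      by (rule Lim_transform_eventually)
    then show ?thesis
      by (simp add: has_real_derivative_iff_has_vector_derivative[symmetric] has_field_derivative_iff
          inverse_eq_divide)
  qed
  fix k assume k: "Ck_on k ?J ?g"
  have "smooth_on ?J (\<lambda>x. 1 / dx \<phi> x)"
    using pos by (intro smooth_on_divide_pos smooth_on_dx smooth smooth_on_const)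
  then have "Ck_on k ?J (\<lambda>y. 1 / dx \<phi> (?g y))"
    using Ck_on_compose[OF k, of ?J "\<lambda>x. 1 / dx \<phi> x"] gJ unfolding smooth_on_def by blast
  then show "Ck_on (Suc k) ?J ?g"
    unfolding Ck_on_Suc_real by (intro exI[of _ "\<lambda>y. 1 / dx \<phi> (?g y)"] conjI ballI deriv)
qed

lemma ds_cong:
  assumes "\<And>y. y \<in> {-1..1} \<Longrightarrow> c y = c' y" "\<And>y. y \<in> {-1..1} \<Longrightarrow> f y = f' y" "x \<in> {-1..1}"
  shows "ds c f x = ds c' f' x"
  using dx_cong[OF assms(1,3)] dx_cong[OF assms(2,3)] by (simp add: ds_def)

lemma curvature_cong:
  assumes "\<And>y. y \<in> {-1..1} \<Longrightarrow> c y = c' y" "x \<in> {-1..1}"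
  shows "curvature c x = curvature c' x"
  unfolding curvature_def by (intro ds_cong assms)

lemma ds_perp_cong:
  assumes "\<And>y. y \<in> {-1..1} \<Longrightarrow> c y = c' y" "\<And>y. y \<in> {-1..1} \<Longrightarrow> f y = f' y" "x \<in> {-1..1}"
  shows "ds_perp c f x = ds_perp c' f' x"
  using ds_cong[OF assms] ds_cong[OF assms(1) assms(1) assms(3)] by (simp add: ds_perp_def perp_def)

lemma immersion_cong:
  assumes "\<And>y. y \<in> {-1..1} \<Longrightarrow> c y = c' y"
  shows "immersion c \<longleftrightarrow> immersion c'"
  unfolding immersion_def using Ck_on_cong[of "{-1..1}" c c' 1] dx_cong[of c c'] assms by simp

text \<open>At time zero the curve has limited regularity only, so that the chain rule is not available; but the
  reparametrisation is the identity there, and the boundary conditions only see the values on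
  \<open>[-1,1]\<close>.\<close>

lemma FBC_cong:
  assumes "\<And>y. y \<in> {-1..1} \<Longrightarrow> c y = c' y"
  shows "FBC M \<xi> c \<longleftrightarrow> FBC M \<xi> c'"
proof -
  have "c x = c' x" "ds c c x = ds c' c' x" "curvature c x = curvature c' x"
    "ds_perp c (curvature c) x = ds_perp c' (curvature c') x" if "x \<in> {-1, 1}" for x
    using that assms by (auto intro!: ds_cong curvature_cong ds_perp_cong)
  then show ?thesis unfolding FBC_def by simp
qed

definition smooth_immersed_curve :: "(real \<Rightarrow> 'a::euclidean_space) \<Rightarrow> bool" where
  "smooth_immersed_curve c \<longleftrightarrow> smooth_on {-1..1} c \<and> (\<forall>x\<in>{-1..1}. dx c x \<noteq> 0)"

context
  fixes c :: "real \<Rightarrow> 'a::euclidean_space"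
  assumes curve: "smooth_immersed_curve c"
begin

lemma smooth_curve: "smooth_on {-1..1} c"
  and dx_nonzero: "x \<in> {-1..1} \<Longrightarrow> dx c x \<noteq> 0"
  using curve by (simp_all add: smooth_immersed_curve_def)

lemma immersion_smooth_curve: "immersion c"
  using smooth_curve dx_nonzero unfolding immersion_def smooth_on_def by blast

lemma smooth_on_ds: "smooth_on {-1..1} f \<Longrightarrow> smooth_on {-1..1} (ds c f)"
  unfolding ds_def[abs_def]
  by (intro smooth_on_scaleR smooth_on_inverse_norm smooth_on_dx smooth_curve dx_nonzero)

lemma smooth_on_curvature: "smooth_on {-1..1} (curvature c)"
  unfolding curvature_def by (intro smooth_on_ds smooth_curve)

lemma smooth_on_ds_perp: "smooth_on {-1..1} f \<Longrightarrow> smooth_on {-1..1} (ds_perp c f)"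
  unfolding ds_perp_def perp_def[abs_def]
  by (intro smooth_on_diff smooth_on_scaleR smooth_on_inner smooth_on_ds smooth_curve)

lemma smooth_on_grad_energy: "smooth_on {-1..1} (grad_energy c)"
  unfolding grad_energy_def[abs_def] power2_norm_eq_inner
  by (intro smooth_on_add smooth_on_scaleR smooth_on_inner smooth_on_const smooth_on_ds_perp
      smooth_on_curvature)

end

context
  fixes \<phi> :: "real \<Rightarrow> real"
  assumes reparam: "increasing_reparam \<phi>"
begin

lemma smooth_phi: "smooth_on {-1..1} \<phi>" and dx_phi_pos: "x \<in> {-1..1} \<Longrightarrow> dx \<phi> x > 0"
  and phi_ends: "\<phi> (-1) = -1" "\<phi> 1 = 1"
  using reparam by (simp_all add: increasing_reparam_def)

lemma phi_range: "x \<in> {-1..1} \<Longrightarrow> \<phi> x \<in> {-1..1}"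
  by (rule increasing_reparam_range[OF reparam])

lemma phi_image: "\<phi> ` {-1..1} \<subseteq> {-1..1}"
  using phi_range by blast

lemma dx_reparam:
  assumes "smooth_on {-1..1} f" "x \<in> {-1..1}"
  shows "dx (\<lambda>x. f (\<phi> x)) x = dx \<phi> x *\<^sub>R dx f (\<phi> x)"
proof (rule dx_eqI[OF _ assms(2)])
  have "(f has_vector_derivative dx f (\<phi> x)) (at (\<phi> x) within \<phi> ` {-1..1})"
    by (rule has_vector_derivative_within_subset[OF smooth_on_has_dx[OF assms(1) phi_range[OF assms(2)]] phi_image])
  from vector_diff_chain_within[OF smooth_on_has_dx[OF smooth_phi assms(2)] this]
  show "((\<lambda>x. f (\<phi> x)) has_vector_derivative dx \<phi> x *\<^sub>R dx f (\<phi> x)) (at x within {-1..1})"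
    by (simp add: o_def)
qed

lemma smooth_reparam: "smooth_on {-1..1} f \<Longrightarrow> smooth_on {-1..1} (\<lambda>x. f (\<phi> x))"
  by (rule smooth_on_compose[OF _ smooth_phi phi_image])

context
  fixes c :: "real \<Rightarrow> 'a::euclidean_space"
  assumes curve: "smooth_immersed_curve c"
begin

lemma smooth_immersed_curve_reparam: "smooth_immersed_curve (\<lambda>x. c (\<phi> x))"
  unfolding smooth_immersed_curve_def
proof (intro conjI ballI)
  show "smooth_on {-1..1} (\<lambda>x. c (\<phi> x))" by (rule smooth_reparam[OF smooth_curve[OF curve]])
  show "dx (\<lambda>x. c (\<phi> x)) x \<noteq> 0" if "x \<in> {-1..1}" for x
    using dx_reparam[OF smooth_curve[OF curve] that] dx_phi_pos[OF that]
      dx_nonzero[OF curve phi_range[OF that]] by simp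
qed

lemma norm_dx_reparam: "x \<in> {-1..1} \<Longrightarrow> norm (dx (\<lambda>x. c (\<phi> x)) x) = dx \<phi> x * norm (dx c (\<phi> x))"
  using dx_reparam[OF smooth_curve[OF curve], of x] dx_phi_pos[of x] by simp

text \<open>The factor \<open>\<phi>'\<close> from the chain rule cancels in \<open>\<partial>\<^sub>s\<close> because \<open>\<phi>\<close> increases; a decreasing \<open>\<phi>\<close> would
  reverse the tangent.  By iteration, all geometric quantities of \<open>c \<circ> \<phi>\<close> at \<open>x\<close> are those of \<open>c\<close> at
  \<open>\<phi> x\<close>.\<close>

lemma ds_reparam:
  assumes "smooth_on {-1..1} f" "\<And>x. x \<in> {-1..1} \<Longrightarrow> f' x = f (\<phi> x)" "x \<in> {-1..1}"
  shows "ds (\<lambda>x. c (\<phi> x)) f' x = ds c f (\<phi> x)"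
proof -
  have "dx f' x = dx \<phi> x *\<^sub>R dx f (\<phi> x)"
    using dx_cong[of f' "\<lambda>x. f (\<phi> x)" x] dx_reparam[OF assms(1,3)] assms by simp
  then show ?thesis
    using norm_dx_reparam[OF assms(3)] dx_phi_pos[OF assms(3)] by (simp add: ds_def)
qed

lemma tangent_reparam: "x \<in> {-1..1} \<Longrightarrow> ds (\<lambda>x. c (\<phi> x)) (\<lambda>x. c (\<phi> x)) x = ds c c (\<phi> x)"
  by (rule ds_reparam[OF smooth_curve[OF curve]]) auto

lemma curvature_reparam: "x \<in> {-1..1} \<Longrightarrow> curvature (\<lambda>x. c (\<phi> x)) x = curvature c (\<phi> x)"
  unfolding curvature_def by (rule ds_reparam[OF smooth_on_ds[OF curve smooth_curve[OF curve]] tangent_reparam])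

lemma ds_perp_reparam:
  assumes "smooth_on {-1..1} f" "\<And>x. x \<in> {-1..1} \<Longrightarrow> f' x = f (\<phi> x)" "x \<in> {-1..1}"
  shows "ds_perp (\<lambda>x. c (\<phi> x)) f' x = ds_perp c f (\<phi> x)"
  using ds_reparam[OF assms] tangent_reparam[OF assms(3)] by (simp add: ds_perp_def perp_def)

lemma grad_energy_reparam:
  assumes "x \<in> {-1..1}"
  shows "grad_energy (\<lambda>x. c (\<phi> x)) x = grad_energy c (\<phi> x)"
proof -
  have "ds_perp (\<lambda>x. c (\<phi> x)) (ds_perp (\<lambda>x. c (\<phi> x)) (curvature (\<lambda>x. c (\<phi> x)))) x =
      ds_perp c (ds_perp c (curvature c)) (\<phi> x)"
    by (intro ds_perp_reparam smooth_on_ds_perp[OF curve] smooth_on_curvature[OF curve] curvature_reparam assms)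
  then show ?thesis using curvature_reparam[OF assms] by (simp add: grad_energy_def)
qed

lemma arclength_integral_reparam:
  assumes "continuous_on {-1..1} h" "\<And>x. x \<in> {-1..1} \<Longrightarrow> h' x = h (\<phi> x)"
  shows "arclength_integral (\<lambda>x. c (\<phi> x)) h' = arclength_integral c h"
proof -
  let ?f = "\<lambda>x. h x * norm (dx c x)"
  have "((\<lambda>x. dx \<phi> x *\<^sub>R ?f (\<phi> x)) has_integral integral {\<phi> (-1)..\<phi> 1} ?f) {-1..1}"
  proof (rule has_integral_substitution[where c="-1" and d=1])
    show "continuous_on {-1..1} ?f"
      using smooth_on_continuous[OF smooth_on_dx[OF smooth_curve[OF curve]]] by (intro continuous_intros assms(1))
    show "(\<phi> has_real_derivative dx \<phi> x) (at x within {-1..1})" if "x \<in> {-1..1}" for x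
      using smooth_on_has_dx[OF smooth_phi that] by (simp add: has_real_derivative_iff_has_vector_derivative)
  qed (use phi_image phi_ends in simp_all)
  then have "integral {-1..1} (\<lambda>x. dx \<phi> x *\<^sub>R ?f (\<phi> x)) = arclength_integral c h"
    by (simp add: arclength_integral_def phi_ends has_integral_iff)
  moreover have "integral {-1..1} (\<lambda>x. dx \<phi> x *\<^sub>R ?f (\<phi> x)) = arclength_integral (\<lambda>x. c (\<phi> x)) h'"
    unfolding arclength_integral_def
    by (rule integral_cong) (use assms(2) norm_dx_reparam in simp)
  ultimately show ?thesis by simp
qed

lemma energy_reparam: "energy (\<lambda>x. c (\<phi> x)) = energy c"
  unfolding energy_def power2_norm_eq_inner
  by (rule arclength_integral_reparam)
     (simp_all add: curvature_reparam smooth_on_continuous smooth_on_inner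
       smooth_on_curvature[OF curve])

lemma lambda_reparam: "lambda (\<lambda>x. c (\<phi> x)) = lambda c"
proof -
  have "arclength_integral (\<lambda>x. c (\<phi> x)) (\<lambda>x. grad_energy (\<lambda>x. c (\<phi> x)) x \<bullet> curvature (\<lambda>x. c (\<phi> x)) x) =
      arclength_integral c (\<lambda>x. grad_energy c x \<bullet> curvature c x)"
    by (rule arclength_integral_reparam)
       (simp_all add: curvature_reparam grad_energy_reparam smooth_on_continuous smooth_on_inner
         smooth_on_curvature[OF curve] smooth_on_grad_energy[OF curve])
  then show ?thesis by (simp add: lambda_def energy_reparam)
qed

lemma FBC_reparam: "FBC M \<xi> c \<Longrightarrow> FBC M \<xi> (\<lambda>x. c (\<phi> x))"
  using ds_perp_reparam[OF smooth_on_curvature[OF curve] curvature_reparam] tangent_reparam curvature_reparam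
  by (simp add: FBC_def phi_ends)

end

end

section \<open>Weak derivatives\<close>

lemma smooth_on_UNIV_deriv:
  fixes \<eta> :: "real \<Rightarrow> real"
  assumes "smooth_on UNIV \<eta>"
  shows "(\<eta> has_real_derivative deriv \<eta> x) (at x)" "smooth_on UNIV (deriv \<eta>)"
proof -
  have D: "(\<eta> has_real_derivative deriv \<eta> x) (at x)" for x
  proof -
    have "Ck_on (Suc 0) UNIV \<eta>" using assms unfolding smooth_on_def by blast
    then obtain f' where "(\<eta> has_vector_derivative f' x) (at x)"
      unfolding Ck_on_Suc_real by auto
    then have "(\<eta> has_real_derivative f' x) (at x)"
      by (simp add: has_real_derivative_iff_has_vector_derivative)
    then show ?thesis using DERIV_imp_deriv by metis
  qed
  then show "(\<eta> has_real_derivative deriv \<eta> x) (at x)" .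
  show "smooth_on UNIV (deriv \<eta>)"
    unfolding smooth_on_def
  proof
    fix k
    have "Ck_on (Suc k) UNIV \<eta>" using assms unfolding smooth_on_def by blast
    then obtain f' where f': "\<forall>x. (\<eta> has_vector_derivative f' x) (at x)" "Ck_on k UNIV f'"
      unfolding Ck_on_Suc_real by auto
    have "deriv \<eta> = f'"
      using f'(1) by (intro ext DERIV_imp_deriv) (simp add: has_real_derivative_iff_has_vector_derivative)
    then show "Ck_on k UNIV (deriv \<eta>)" using f'(2) by simp
  qed
qed

lemma test_function_deriv:
  assumes "test_function \<eta>"
  shows "test_function (deriv \<eta>)"
proof -
  from assms obtain a b where \<eta>: "smooth_on UNIV \<eta>" and ab: "-1 < a" "b < 1"
    and zero: "\<And>x. x \<notin> {a..b} \<Longrightarrow> \<eta> x = 0"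
    unfolding test_function_def by blast
  have "deriv \<eta> x = 0" if "x \<notin> {a..b}" for x
  proof -
    have "((\<lambda>x. 0) has_real_derivative 0) (at x)" by simp
    then have "(\<eta> has_real_derivative 0) (at x)"
      by (rule has_field_derivative_transform_within_open[of _ _ _ "- {a..b}"])
         (use zero that in \<open>auto simp: open_Compl\<close>)
    then show ?thesis by (rule DERIV_imp_deriv)
  qed
  then show ?thesis
    using smooth_on_UNIV_deriv(2)[OF \<eta>] ab unfolding test_function_def by blast
qed

lemma is_weak_deriv_dx:
  assumes w: "is_weak_deriv j f g" and g: "smooth_on {-1..1} g"
  shows "is_weak_deriv (Suc j) f (dx g)"
  unfolding is_weak_deriv_def
proof (intro conjI allI impI)
  show "dx g absolutely_integrable_on {-1..1}"
    by (intro absolutely_integrable_continuous_real smooth_on_continuous smooth_on_dx g)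
  fix \<eta> assume t: "test_function \<eta>"
  then obtain a b where \<eta>: "smooth_on UNIV \<eta>" and ab: "-1 < a" "b < 1"
    and zero: "\<And>x. x \<notin> {a..b} \<Longrightarrow> \<eta> x = 0"
    unfolding test_function_def by blast
  have d\<eta>: "(\<eta> has_real_derivative deriv \<eta> x) (at x within {-1..1})" for x
    using smooth_on_UNIV_deriv(1)[OF \<eta>] by (rule DERIV_subset) simp
  have "((\<lambda>x. \<eta> x *\<^sub>R dx g x + deriv \<eta> x *\<^sub>R g x) has_integral (\<eta> 1 *\<^sub>R g 1 - \<eta> (-1) *\<^sub>R g (-1))) {-1..1}"
    by (rule fundamental_theorem_of_calculus)
       (auto intro!: has_vector_derivative_scaleR d\<eta> smooth_on_has_dx g)
  moreover have "\<eta> 1 = 0" "\<eta> (-1) = 0" using zero ab by auto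
  ultimately have sum0: "((\<lambda>x. \<eta> x *\<^sub>R dx g x + deriv \<eta> x *\<^sub>R g x) has_integral 0) {-1..1}" by simp
  have cont: "continuous_on {-1..1} \<eta>" "continuous_on {-1..1} (deriv \<eta>)"
    using smooth_on_continuous[OF \<eta>] smooth_on_continuous[OF smooth_on_UNIV_deriv(2)[OF \<eta>]]
    by (auto intro: continuous_on_subset)
  have int: "(\<lambda>x. \<eta> x *\<^sub>R dx g x) integrable_on {-1..1}" "(\<lambda>x. deriv \<eta> x *\<^sub>R g x) integrable_on {-1..1}"
    by (intro integrable_continuous_real continuous_on_scaleR cont smooth_on_continuous smooth_on_dx g)+
  have "integral {-1..1} (\<lambda>x. \<eta> x *\<^sub>R dx g x) + integral {-1..1} (\<lambda>x. deriv \<eta> x *\<^sub>R g x) = 0"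
    using integral_unique[OF sum0] integral_add[OF int] by simp
  then have parts: "integral {-1..1} (\<lambda>x. deriv \<eta> x *\<^sub>R g x) = - integral {-1..1} (\<lambda>x. \<eta> x *\<^sub>R dx g x)"
    by (simp add: add_eq_0_iff)
  have "integral {-1..1} (\<lambda>x. (deriv ^^ Suc j) \<eta> x *\<^sub>R f x) =
      integral {-1..1} (\<lambda>x. (deriv ^^ j) (deriv \<eta>) x *\<^sub>R f x)"
    by (simp only: funpow_Suc_right o_apply)
  also have "\<dots> = (-1) ^ j *\<^sub>R integral {-1..1} (\<lambda>x. deriv \<eta> x *\<^sub>R g x)"
    using w test_function_deriv[OF t] unfolding is_weak_deriv_def by blast
  also have "\<dots> = (-1) ^ Suc j *\<^sub>R integral {-1..1} (\<lambda>x. \<eta> x *\<^sub>R dx g x)"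
    by (simp add: parts)
  finally show "integral {-1..1} (\<lambda>x. (deriv ^^ Suc j) \<eta> x *\<^sub>R f x) =
      (-1) ^ Suc j *\<^sub>R integral {-1..1} (\<lambda>x. \<eta> x *\<^sub>R dx g x)" .
qed

lemma smooth_on_dx_funpow: "smooth_on {-1..1} f \<Longrightarrow> smooth_on {-1..1} ((dx ^^ j) f)"
  by (induction j) (auto intro: smooth_on_dx)

lemma is_weak_deriv_smooth:
  assumes "smooth_on {-1..1} f"
  shows "is_weak_deriv j f ((dx ^^ j) f)"
proof (induction j)
  case 0
  then show ?case
    using assms by (auto simp: is_weak_deriv_def
        intro: absolutely_integrable_continuous_real smooth_on_continuous)
next
  case (Suc j)
  show ?case using is_weak_deriv_dx[OF Suc smooth_on_dx_funpow[OF assms]] by simp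
qed

text \<open>The indicator function of \<open>(a,b)\<close> is the pointwise limit of products of two smooth steps, which are
  test functions bounded by one.\<close>

lemma integral_zero_of_test_functions:
  fixes d :: "real \<Rightarrow> 'a::euclidean_space"
  assumes d: "d absolutely_integrable_on {-1..1}"
    and zero: "\<And>\<eta>. test_function \<eta> \<Longrightarrow> integral {-1..1} (\<lambda>x. \<eta> x *\<^sub>R d x) = 0"
    and ab: "-1 < a" "b < 1"
  shows "integral {a..b} d = 0"
proof -
  define \<eta> where "\<eta> n x = smooth_step (real (Suc n) * (x - a)) * smooth_step (real (Suc n) * (b - x))"
    for n x
  have smooth: "smooth_on UNIV (\<eta> n)" for n
    unfolding \<eta>_def[abs_def]
    by (intro smooth_on_intros smooth_on_compose[OF smooth_on_smooth_step]) auto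
  have out: "\<eta> n x = 0" if "x \<notin> {a<..<b}" for n x
  proof -
    have "real (Suc n) * (x - a) \<le> 0 \<or> real (Suc n) * (b - x) \<le> 0"
      using that by (auto simp: mult_le_0_iff)
    then show ?thesis by (auto simp: \<eta>_def smooth_step_0)
  qed
  have "test_function (\<eta> n)" for n
    unfolding test_function_def using smooth out ab by (intro conjI exI[of _ a] exI[of _ b]) auto
  then have int0: "integral {-1..1} (\<lambda>x. \<eta> n x *\<^sub>R d x) = 0" for n by (rule zero)
  have bound: "0 \<le> \<eta> n x \<and> \<eta> n x \<le> 1" for n x
    unfolding \<eta>_def using smooth_step_bounds by (simp add: mult_le_one)
  have lim: "(\<lambda>n. \<eta> n x) \<longlonglongrightarrow> (if x \<in> {a<..<b} then 1 else 0)" for x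
  proof (cases "x \<in> {a<..<b}")
    case True
    \<comment> \<open>Both steps are eventually equal to one at an interior point.\<close>
    have one: "eventually (\<lambda>n. smooth_step (real (Suc n) * y) = 1) sequentially" if "y > 0" for y
    proof -
      from real_arch_simple obtain N :: nat where N: "1 / y \<le> real N" by blast
      have "smooth_step (real (Suc n) * y) = 1" if "n \<ge> N" for n
      proof -
        have "1 / y \<le> real (Suc n)" using N that by simp
        then show ?thesis using \<open>y > 0\<close> by (intro smooth_step_1) (simp add: field_simps)
      qed
      then show ?thesis unfolding eventually_sequentially by blast
    qed
    have "eventually (\<lambda>n. \<eta> n x = 1) sequentially"
      using eventually_conj[OF one[of "x - a"] one[of "b - x"]] True
      by (auto simp: \<eta>_def elim: eventually_mono)
    then show ?thesis using True by (auto intro: tendsto_eventually)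
  next
    case False
    then have "\<eta> n x = 0" for n by (rule out)
    then show ?thesis by (simp only: False if_False tendsto_const)
  qed
  have "(\<lambda>n. integral {-1..1} (\<lambda>x. \<eta> n x *\<^sub>R d x)) \<longlonglongrightarrow>
      integral {-1..1} (\<lambda>x. (if x \<in> {a<..<b} then 1 else 0) *\<^sub>R d x)"
  proof (rule dominated_convergence(2))
    show "(\<lambda>x. \<eta> n x *\<^sub>R d x) integrable_on {-1..1}" for n
    proof -
      have "continuous_on {-1..1} (\<eta> n)"
        using smooth_on_continuous[OF smooth] by (rule continuous_on_subset) simp
      then have m: "\<eta> n \<in> borel_measurable (lebesgue_on {-1..1})"
        by (rule continuous_imp_measurable_on_sets_lebesgue) simp
      have b: "bounded (\<eta> n ` {-1..1})"
        unfolding bounded_iff using bound by (intro exI[of _ 1]) auto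
      have "(\<lambda>x. \<eta> n x *\<^sub>R d x) absolutely_integrable_on {-1..1}"
        by (rule absolutely_integrable_bounded_measurable_product[OF _ m _ b d])
           (auto simp: bilinear_conv_bounded_bilinear bounded_bilinear_scaleR)
      then show ?thesis using absolutely_integrable_on_def by blast
    qed
    show "(\<lambda>x. norm (d x)) integrable_on {-1..1}" using d absolutely_integrable_on_def by blast
    show "norm (\<eta> n x *\<^sub>R d x) \<le> norm (d x)" for n x
      using bound[of n x] mult_right_mono[of "\<eta> n x" 1 "norm (d x)"] by simp
    show "(\<lambda>n. \<eta> n x *\<^sub>R d x) \<longlonglongrightarrow> (if x \<in> {a<..<b} then 1 else 0) *\<^sub>R d x" for x
      by (intro tendsto_intros lim)
  qed
  then have "integral {-1..1} (\<lambda>x. (if x \<in> {a<..<b} then 1 else 0) *\<^sub>R d x) = 0"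
    using int0 LIMSEQ_unique[OF _ tendsto_const] by simp
  moreover have "(\<lambda>x. (if x \<in> {a<..<b} then 1 else 0) *\<^sub>R d x) = (\<lambda>x. if x \<in> {a<..<b} then d x else 0)"
    by auto
  moreover have "{a<..<b} \<inter> {-1..1} = {a<..<b}" using ab by auto
  ultimately have "integral {a<..<b} d = 0"
    using integral_restrict_Int[of "{-1..1}" "{a<..<b}" d] by simp
  then show ?thesis by (simp add: integral_open_interval_real)
qed

text \<open>Since \<open>d\<close> has vanishing integral over every small interval, it vanishes wherever it is the limit of
  its own averages, that is, almost everywhere.\<close>

lemma fundamental_lemma_of_variations:
  fixes d :: "real \<Rightarrow> 'a::euclidean_space"
  assumes d: "d absolutely_integrable_on {-1..1}"
    and zero: "\<And>\<eta>. test_function \<eta> \<Longrightarrow> integral {-1..1} (\<lambda>x. \<eta> x *\<^sub>R d x) = 0"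
  obtains N where "negligible N" "\<And>x. x \<in> {-1..1} - N \<Longrightarrow> d x = 0"
proof -
  define e where "e x = (if x \<in> {-1..1} then d x else 0)" for x
  have "d integrable_on {-1..1}" using d absolutely_integrable_on_def by blast
  then have "e integrable_on UNIV"
    using integrable_restrict_UNIV[of "{-1..1}" d] by (simp only: e_def[abs_def])
  then have "e integrable_on cbox a b" for a b by (rule integrable_on_subcbox) simp
  from integrable_ccontinuous_explicit[OF this] obtain N where N: "negligible N"
    "\<And>x \<epsilon>. x \<notin> N \<Longrightarrow> 0 < \<epsilon> \<Longrightarrow> \<exists>\<delta>>0. \<forall>h. 0 < h \<and> h < \<delta> \<longrightarrow>
        norm (integral (cbox x (x + h *\<^sub>R One)) e /\<^sub>R h ^ DIM(real) - e x) < \<epsilon>" by blast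
  have "d x = 0" if x: "x \<in> {-1..1} - (N \<union> {-1, 1})" for x
  proof (rule ccontr)
    assume "d x \<noteq> 0"
    then obtain \<delta> where \<delta>: "\<delta> > 0" "\<And>h. 0 < h \<Longrightarrow> h < \<delta> \<Longrightarrow>
        norm (integral {x..x + h} e /\<^sub>R h - e x) < norm (d x)"
      using N(2)[of x "norm (d x)"] x by auto
    define h where "h = min (\<delta> / 2) ((1 - x) / 2)"
    have h: "0 < h" "h < \<delta>" "x + h < 1" using \<delta>(1) x by (auto simp: h_def min_def field_simps)
    have "integral {x..x + h} e = integral {x..x + h} d"
      by (rule integral_cong) (use h x in \<open>auto simp: e_def\<close>)
    also have "\<dots> = 0"
      by (rule integral_zero_of_test_functions[OF d zero]) (use h x in auto)
    finally show False using \<delta>(2)[OF h(1,2)] x by (simp add: e_def)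
  qed
  moreover have "negligible (N \<union> {-1, 1})" using N(1) by simp
  ultimately show ?thesis using that by blast
qed

lemma is_weak_deriv_unique:
  assumes g: "is_weak_deriv j f g" and h: "is_weak_deriv j f h"
  obtains N where "negligible N" "\<And>x. x \<in> {-1..1} - N \<Longrightarrow> g x = h x"
proof -
  have int: "g absolutely_integrable_on {-1..1}" "h absolutely_integrable_on {-1..1}"
    using g h by (auto simp: is_weak_deriv_def)
  have zero: "integral {-1..1} (\<lambda>x. \<eta> x *\<^sub>R (g x - h x)) = 0" if t: "test_function \<eta>" for \<eta>
  proof -
    have "continuous_on {-1..1} \<eta>"
      using t smooth_on_continuous unfolding test_function_def by (metis continuous_on_subset subset_UNIV)
    then have m: "\<eta> \<in> borel_measurable (lebesgue_on {-1..1})" and b: "bounded (\<eta> ` {-1..1})"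
      by (auto intro: continuous_imp_measurable_on_sets_lebesgue compact_imp_bounded compact_continuous_image)
    have i: "(\<lambda>x. \<eta> x *\<^sub>R f x) integrable_on {-1..1}" if "f absolutely_integrable_on {-1..1}"
      for f :: "real \<Rightarrow> 'a"
    proof -
      have "(\<lambda>x. \<eta> x *\<^sub>R f x) absolutely_integrable_on {-1..1}"
        by (rule absolutely_integrable_bounded_measurable_product[OF _ m _ b that])
           (auto simp: bilinear_conv_bounded_bilinear bounded_bilinear_scaleR)
      then show ?thesis using absolutely_integrable_on_def by blast
    qed
    have "(-1) ^ j *\<^sub>R integral {-1..1} (\<lambda>x. \<eta> x *\<^sub>R g x) = (-1) ^ j *\<^sub>R integral {-1..1} (\<lambda>x. \<eta> x *\<^sub>R h x)"
      using g[unfolded is_weak_deriv_def, THEN conjunct2, rule_format, OF t]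
        h[unfolded is_weak_deriv_def, THEN conjunct2, rule_format, OF t] by (rule trans[OF sym])
    then have "integral {-1..1} (\<lambda>x. \<eta> x *\<^sub>R g x) = integral {-1..1} (\<lambda>x. \<eta> x *\<^sub>R h x)"
      by simp
    then show ?thesis
      using integral_diff[OF i[OF int(1)] i[OF int(2)]] by (simp add: scaleR_diff_right)
  qed
  have "(\<lambda>x. g x - h x) absolutely_integrable_on {-1..1}"
    using int by (rule set_integral_diff(1))
  from fundamental_lemma_of_variations[OF this zero] obtain N where
    "negligible N" "\<And>x. x \<in> {-1..1} - N \<Longrightarrow> g x - h x = 0" by blast
  then show ?thesis using that by (metis eq_iff_diff_eq_0)
qed

text \<open>\<open>weak_deriv\<close> is an arbitrary representative; by uniqueness it agrees almost everywhere with the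
  classical derivative, which suffices because it only occurs under integrals.\<close>

lemma weak_deriv_smooth:
  assumes "smooth_on {-1..1} f"
  obtains N where "negligible N" "\<And>x. x \<in> {-1..1} - N \<Longrightarrow> weak_deriv j f x = (dx ^^ j) f x"
proof -
  have "is_weak_deriv j f (weak_deriv j f)"
    unfolding weak_deriv_def by (rule someI[where P="is_weak_deriv j f", OF is_weak_deriv_smooth[OF assms]])
  from is_weak_deriv_unique[OF this is_weak_deriv_smooth[OF assms]] show ?thesis using that by blast
qed

lemma weak_deriv_cong:
  assumes "\<And>x. x \<in> {-1..1} \<Longrightarrow> f x = g x"
  shows "is_weak_deriv j f = is_weak_deriv j g" "weak_deriv j f = weak_deriv j g"
proof -
  have "integral {-1..1} (\<lambda>x. (deriv ^^ j) \<eta> x *\<^sub>R f x) = integral {-1..1} (\<lambda>x. (deriv ^^ j) \<eta> x *\<^sub>R g x)"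
    for \<eta>
    by (rule integral_cong) (use assms in simp)
  then show "is_weak_deriv j f = is_weak_deriv j g" by (simp add: is_weak_deriv_def fun_eq_iff)
  then show "weak_deriv j f = weak_deriv j g" by (simp add: weak_deriv_def)
qed

lemma in_Wsp_cong:
  assumes "\<And>x. x \<in> {-1..1} \<Longrightarrow> f x = g x"
  shows "in_Wsp s p f \<longleftrightarrow> in_Wsp s p g"
proof -
  have "f absolutely_integrable_on {-1..1} \<longleftrightarrow> g absolutely_integrable_on {-1..1}"
    by (rule set_integrable_cong) (use assms in auto)
  then show ?thesis using weak_deriv_cong[of f g] assms by (simp add: in_Wsp_def)
qed

lemma Wsp_norm_cong:
  assumes "\<And>x. x \<in> {-1..1} \<Longrightarrow> f x = g x"
  shows "Wsp_norm s p f = Wsp_norm s p g"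
  using weak_deriv_cong[of f g] assms by (simp add: Wsp_norm_def)

section \<open>Smooth functions in Sobolev--Slobodetskii spaces\<close>

lemma negligible_times_UNIV:
  fixes N :: "'a::euclidean_space set"
  assumes "negligible N"
  shows "negligible (N \<times> (UNIV :: 'b::euclidean_space set))" "negligible ((UNIV :: 'b set) \<times> N)"
proof -
  from assms obtain N' where N': "N' \<in> null_sets lborel" "N \<subseteq> N'"
    using null_sets_completion_iff2[of N lborel] unfolding negligible_iff_null_sets by blast
  have "N' \<times> (UNIV :: 'b set) \<in> null_sets (lborel \<Otimes>\<^sub>M lborel)"
    "(UNIV :: 'b set) \<times> N' \<in> null_sets (lborel \<Otimes>\<^sub>M lborel)"
    using N' by (auto intro: lborel.times_in_null_sets1 lborel.times_in_null_sets2)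
  then have "negligible (N' \<times> (UNIV :: 'b set))" "negligible ((UNIV :: 'b set) \<times> N')"
    by (auto simp: lborel_prod negligible_iff_null_sets intro: null_sets_completionI)
  then show "negligible (N \<times> (UNIV :: 'b set))" "negligible ((UNIV :: 'b set) \<times> N)"
    using N'(2) by (auto elim!: negligible_subset)
qed

lemma gagliardo_integrand_cong_ae:
  assumes "negligible N" "\<And>x. x \<in> {-1..1} - N \<Longrightarrow> g x = h x"
  obtains N2 where "negligible N2" "\<And>z. z \<in> ({-1..1} \<times> {-1..1}) - N2 \<Longrightarrow>
      gagliardo_integrand \<theta> p g z = gagliardo_integrand \<theta> p h z"
proof
  show "negligible (N \<times> UNIV \<union> UNIV \<times> N)"
    using negligible_times_UNIV[OF assms(1)] by (intro negligible_Un)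
  show "gagliardo_integrand \<theta> p g z = gagliardo_integrand \<theta> p h z"
    if "z \<in> ({-1..1} \<times> {-1..1}) - (N \<times> UNIV \<union> UNIV \<times> N)" for z
    using that assms(2) by (cases z) (auto simp: gagliardo_integrand_def)
qed

text \<open>The kernel has the exponent \<open>1 + (1 - 4/p) p = p - 3\<close>, whereas the numerator decays like
  \<open>\<bar>x - y\<bar>\<^sup>p\<close>; what remains is \<open>\<bar>x - y\<bar>\<^sup>3\<close>, without any singularity.\<close>

lemma gagliardo_integrand_bound:
  assumes p: "p > 5" and M: "M \<ge> 0"
    and Lip: "\<And>x y. x \<in> {-1..1} \<Longrightarrow> y \<in> {-1..1} \<Longrightarrow> norm (g x - g y) \<le> M * \<bar>x - y\<bar>"
    and xy: "x \<in> {-1..1}" "y \<in> {-1..1}"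
  shows "0 \<le> gagliardo_integrand (1 - 4 / p) p g (x, y)"
    "gagliardo_integrand (1 - 4 / p) p g (x, y) \<le> M powr p * \<bar>x - y\<bar> powr 3"
proof -
  show "0 \<le> gagliardo_integrand (1 - 4 / p) p g (x, y)" by (simp add: gagliardo_integrand_def)
  have e: "1 + (1 - 4 / p) * p = p - 3" using p by (simp add: field_simps)
  have "norm (g x - g y) powr p \<le> (M * \<bar>x - y\<bar>) powr p"
    using Lip[OF xy] p by (intro powr_mono2) auto
  also have "\<dots> = M powr p * \<bar>x - y\<bar> powr p" using M by (simp add: powr_mult)
  finally have "norm (g x - g y) powr p / \<bar>x - y\<bar> powr (p - 3) \<le>
      M powr p * \<bar>x - y\<bar> powr p / \<bar>x - y\<bar> powr (p - 3)"
    by (intro divide_right_mono) auto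
  also have "\<dots> = M powr p * \<bar>x - y\<bar> powr 3"
    using powr_diff[of "\<bar>x - y\<bar>" p "p - 3"] by simp
  finally show "gagliardo_integrand (1 - 4 / p) p g (x, y) \<le> M powr p * \<bar>x - y\<bar> powr 3"
    by (simp add: gagliardo_integrand_def e)
qed

lemma gagliardo_integrand_continuous:
  assumes p: "p > 5" and M: "M \<ge> 0"
    and Lip: "\<And>x y. x \<in> {-1..1} \<Longrightarrow> y \<in> {-1..1} \<Longrightarrow> norm (g x - g y) \<le> M * \<bar>x - y\<bar>"
    and cont: "continuous_on {-1..1} g"
  shows "continuous_on ({-1..1} \<times> {-1..1}) (gagliardo_integrand (1 - 4 / p) p g)"
  unfolding continuous_on_def
proof
  let ?D = "{-1..1} \<times> {-1..1} :: (real \<times> real) set" and ?G = "gagliardo_integrand (1 - 4 / p) p g"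
  fix z assume z: "z \<in> ?D"
  then obtain x y where xy: "z = (x, y)" "x \<in> {-1..1}" "y \<in> {-1..1}" by auto
  show "(?G \<longlongrightarrow> ?G z) (at z within ?D)"
  proof (cases "x = y")
    case True
    have "((\<lambda>w. M powr p * \<bar>fst w - snd w\<bar> powr 3) \<longlongrightarrow> M powr p * \<bar>fst z - snd z\<bar> powr 3) (at z within ?D)"
      by (intro tendsto_intros tendsto_powr') auto
    then have lim: "((\<lambda>w. M powr p * \<bar>fst w - snd w\<bar> powr 3) \<longlongrightarrow> 0) (at z within ?D)"
      using True xy by simp
    have "eventually (\<lambda>w. norm (?G w) \<le> M powr p * \<bar>fst w - snd w\<bar> powr 3) (at z within ?D)"
      unfolding eventually_at_filter
      using gagliardo_integrand_bound[OF p M Lip] by (intro always_eventually) auto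
    from Lim_null_comparison[OF this lim] show ?thesis
      using True xy by (simp add: gagliardo_integrand_def)
  next
    case False
    have g1: "continuous_on ?D (\<lambda>w. g (fst w))" and g2: "continuous_on ?D (\<lambda>w. g (snd w))"
      by (rule continuous_on_compose2[OF cont]; auto intro!: continuous_intros)+
    have "((\<lambda>w. g (fst w)) \<longlongrightarrow> g (fst z)) (at z within ?D)" "((\<lambda>w. g (snd w)) \<longlongrightarrow> g (snd z)) (at z within ?D)"
      using g1 g2 z by (auto simp: continuous_on_def)
    then have "((\<lambda>w. norm (g (fst w) - g (snd w)) powr p / \<bar>fst w - snd w\<bar> powr (1 + (1 - 4 / p) * p)) \<longlongrightarrow>
        norm (g (fst z) - g (snd z)) powr p / \<bar>fst z - snd z\<bar> powr (1 + (1 - 4 / p) * p)) (at z within ?D)"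
      using False xy p by (intro tendsto_intros tendsto_powr') auto
    then show ?thesis by (simp add: gagliardo_integrand_def case_prod_beta')
  qed
qed

text \<open>The order \<open>4 (1 - 1/p)\<close> has integer part 3 and fractional part \<open>1 - 4/p\<close>.  Each of the
  four \<open>L\<^sup>p\<close> terms is at most \<open>2 M\<^sup>p\<close>.  The fourth derivative is a Lipschitz constant of the third one
  and bounds the Gagliardo term by \<open>4 \<cdot> 2\<^sup>3 M\<^sup>p\<close>.  This adds up to \<open>40 M\<^sup>p\<close>.\<close>

lemma smooth_Wsp:
  fixes f :: "real \<Rightarrow> 'a::euclidean_space"
  assumes p: "p > 5" and f: "smooth_on {-1..1} f"
    and M: "\<And>j x. j \<le> 4 \<Longrightarrow> x \<in> {-1..1} \<Longrightarrow> norm ((dx ^^ j) f x) \<le> M"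
  shows "in_Wsp (4 * (1 - 1 / p)) p f" "Wsp_norm (4 * (1 - 1 / p)) p f \<le> 40 powr (1 / p) * M"
proof -
  let ?s = "4 * (1 - 1 / p)" and ?J = "{-1..1} :: real set"
  have s: "3 < ?s" "?s < 4" using p by (auto simp: field_simps)
  then have fl: "\<lfloor>?s\<rfloor> = 3" by linarith
  then have fr: "frac ?s = 1 - 4 / p" unfolding frac_def by (simp add: algebra_simps)
  have frpos: "1 - 4 / p > 0" using p by (simp add: field_simps)
  have "0 \<le> norm ((dx ^^ 0) f 0)" by simp
  also have "\<dots> \<le> M" by (rule M) auto
  finally have M0: "M \<ge> 0" .
  have sm: "smooth_on ?J ((dx ^^ j) f)" for j by (rule smooth_on_dx_funpow[OF f])
  have "\<exists>N. negligible N \<and> (\<forall>x\<in>?J - N. weak_deriv j f x = (dx ^^ j) f x)" for j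
    using weak_deriv_smooth[OF f, of j] by metis
  then obtain N where N: "\<And>j. negligible (N j)"
    "\<And>j x. x \<in> ?J - N j \<Longrightarrow> weak_deriv j f x = (dx ^^ j) f x" by metis

  have cpow: "continuous_on ?J (\<lambda>x. norm ((dx ^^ j) f x) powr p)" for j
    using p by (intro continuous_on_powr' continuous_intros smooth_on_continuous sm) auto
  have wint: "(\<lambda>x. norm (weak_deriv j f x) powr p) absolutely_integrable_on ?J" for j
    by (rule absolutely_integrable_spike[OF absolutely_integrable_continuous_real[OF cpow[of j]] N(1)[of j]])
       (use N(2)[of _ j] in simp)
  have wbound: "integral ?J (\<lambda>x. norm (weak_deriv j f x) powr p) \<le> 2 * M powr p" if "j \<le> 4" for j
  proof -
    have "integral ?J (\<lambda>x. norm (weak_deriv j f x) powr p) = integral ?J (\<lambda>x. norm ((dx ^^ j) f x) powr p)"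
      by (rule integral_spike[OF N(1)[of j]]) (use N(2)[of _ j] in simp)
    also have "\<dots> \<le> integral ?J (\<lambda>x. M powr p)"
      using M[OF that] p by (intro integral_le integrable_continuous_real cpow powr_mono2) auto
    finally show ?thesis by simp
  qed

  have Lip: "norm ((dx ^^ 3) f x - (dx ^^ 3) f y) \<le> M * \<bar>x - y\<bar>" if "x \<in> ?J" "y \<in> ?J" for x y
  proof -
    have "norm ((dx ^^ 3) f x - (dx ^^ 3) f y) \<le> M * norm (x - y)"
    proof (rule differentiable_bound[where S="?J" and f'="\<lambda>x h. h *\<^sub>R (dx ^^ 4) f x"])
      show "((dx ^^ 3) f has_derivative (\<lambda>h. h *\<^sub>R (dx ^^ 4) f x)) (at x within ?J)" if "x \<in> ?J" for x
        using smooth_on_has_dx[OF sm[of 3] that]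
        by (simp add: has_vector_derivative_def eval_nat_numeral)
      show "onorm (\<lambda>h::real. h *\<^sub>R (dx ^^ 4) f x) \<le> M" if "x \<in> ?J" for x
        using M[of 4 x] that onorm_scaleR_left[OF bounded_linear_ident, of "(dx ^^ 4) f x"]
        by (simp add: onorm_id)
    qed (use that in auto)
    then show ?thesis by simp
  qed
  let ?G = "gagliardo_integrand (1 - 4 / p) p"
  obtain N2 where N2: "negligible N2"
    "\<And>z. z \<in> ?J \<times> ?J - N2 \<Longrightarrow> ?G (weak_deriv 3 f) z = ?G ((dx ^^ 3) f) z"
    using gagliardo_integrand_cong_ae[OF N(1)[of 3], of "weak_deriv 3 f" "(dx ^^ 3) f"] N(2)[of _ 3] by blast
  have JJ: "?J \<times> ?J = cbox (-1, -1) (1, 1)" by (simp add: cbox_Pair_eq)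
  have contG: "continuous_on (?J \<times> ?J) (?G ((dx ^^ 3) f))"
    by (rule gagliardo_integrand_continuous[OF p M0 Lip smooth_on_continuous[OF sm]])
  have gint: "?G (weak_deriv 3 f) absolutely_integrable_on ?J \<times> ?J"
    by (rule absolutely_integrable_spike[OF _ N2])
       (use absolutely_integrable_continuous[of "(-1, -1)" "(1, 1)"] contG in \<open>auto simp: JJ\<close>)
  have gbound: "integral (?J \<times> ?J) (?G (weak_deriv 3 f)) \<le> 32 * M powr p"
  proof -
    have "integral (?J \<times> ?J) (?G (weak_deriv 3 f)) = integral (?J \<times> ?J) (?G ((dx ^^ 3) f))"
      by (rule integral_spike[OF N2(1)]) (use N2(2) in simp)
    also have "\<dots> \<le> integral (?J \<times> ?J) (\<lambda>z. M powr p * 8)"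
    proof (rule integral_le)
      show "?G ((dx ^^ 3) f) integrable_on ?J \<times> ?J"
        using contG unfolding JJ by (rule integrable_continuous)
      show "(\<lambda>z. M powr p * 8) integrable_on ?J \<times> ?J" unfolding JJ by (intro integrable_continuous continuous_on_const)
      fix z assume "z \<in> ?J \<times> ?J"
      then obtain x y where z: "z = (x, y)" "x \<in> ?J" "y \<in> ?J" by auto
      have "?G ((dx ^^ 3) f) z \<le> M powr p * \<bar>x - y\<bar> powr 3"
        using gagliardo_integrand_bound(2)[OF p M0 Lip z(2,3)] z(1) by simp
      also have "\<dots> \<le> M powr p * 2 powr 3"
        using z by (intro mult_left_mono powr_mono2) auto
      finally show "?G ((dx ^^ 3) f) z \<le> M powr p * 8" by simp
    qed
    also have "\<dots> = 32 * M powr p"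
      unfolding JJ by (simp add: content_Pair)
    finally show ?thesis .
  qed
  show "in_Wsp ?s p f"
    unfolding in_Wsp_def fl fr
    using wint gint is_weak_deriv_smooth[OF f] absolutely_integrable_continuous_real[OF smooth_on_continuous[OF f]]
    by auto
  have "(\<Sum>j\<le>3. integral ?J (\<lambda>x. norm (weak_deriv j f x) powr p)) \<le> (\<Sum>j\<le>(3::nat). 2 * M powr p)"
    by (rule sum_mono) (use wbound in auto)
  then have tot: "(\<Sum>j\<le>3. integral ?J (\<lambda>x. norm (weak_deriv j f x) powr p)) +
      integral (?J \<times> ?J) (?G (weak_deriv 3 f)) \<le> 40 * M powr p"
    using gbound by simp
  have "0 \<le> (\<Sum>j\<le>3. integral ?J (\<lambda>x. norm (weak_deriv j f x) powr p)) + integral (?J \<times> ?J) (?G (weak_deriv 3 f))"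
    using gint by (intro add_nonneg_nonneg sum_nonneg integral_nonneg)
      (use wint absolutely_integrable_on_def in \<open>auto simp: gagliardo_integrand_def\<close>)
  then have "((\<Sum>j\<le>3. integral ?J (\<lambda>x. norm (weak_deriv j f x) powr p)) +
      integral (?J \<times> ?J) (?G (weak_deriv 3 f))) powr (1 / p) \<le> (40 * M powr p) powr (1 / p)"
    using tot p by (intro powr_mono2) auto
  also have "\<dots> = 40 powr (1 / p) * M"
    using M0 p by (simp add: powr_mult powr_powr)
  finally show "Wsp_norm ?s p f \<le> 40 powr (1 / p) * M"
    unfolding Wsp_norm_def fl fr using frpos by simp
qed

lemma dx_funpow_diff:
  assumes "smooth_on {-1..1} f" "smooth_on {-1..1} g" "x \<in> {-1..1}"
  shows "(dx ^^ j) (\<lambda>x. f x - g x) x = (dx ^^ j) f x - (dx ^^ j) g x"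
  using assms(3)
proof (induction j arbitrary: x)
  case (Suc j)
  have "dx ((dx ^^ j) (\<lambda>x. f x - g x)) x = dx (\<lambda>x. (dx ^^ j) f x - (dx ^^ j) g x) x"
    by (rule dx_cong[OF Suc.IH Suc.prems])
  also have "\<dots> = dx ((dx ^^ j) f) x - dx ((dx ^^ j) g) x"
    by (intro dx_eqI has_vector_derivative_diff smooth_on_has_dx smooth_on_dx_funpow assms Suc.prems)
  finally show ?case by simp
qed simp

lemma smooth_in_Wsp:
  fixes f :: "real \<Rightarrow> 'a::euclidean_space"
  assumes p: "p > 5" and f: "smooth_on {-1..1} f"
  shows "in_Wsp (4 * (1 - 1 / p)) p f"
proof -
  have "bounded (\<Union>j\<in>{..4}. (dx ^^ j) f ` {-1..1})"
    by (intro bounded_UN ballI compact_imp_bounded compact_continuous_image smooth_on_continuous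
        smooth_on_dx_funpow f) auto
  then obtain M where "\<forall>y\<in>(\<Union>j\<in>{..4}. (dx ^^ j) f ` {-1..1}). norm y \<le> M"
    using bounded_iff by metis
  then show ?thesis by (intro smooth_Wsp(1)[OF p f, of M]) auto
qed

lemma smooth_family_dx_funpow:
  fixes F :: "real \<times> real \<Rightarrow> 'b::euclidean_space"
  assumes "smooth_on (I \<times> {-1..1}) F"
  shows "smooth_on (I \<times> {-1..1}) (\<lambda>z. (dx ^^ j) (\<lambda>x. F (fst z, x)) (snd z))"
proof (induction j)
  case 0
  then show ?case using assms by simp
next
  case (Suc j)
  from smooth_family_dx[OF this] show ?case by simp
qed

lemma smooth_family_slice:
  fixes F :: "real \<times> real \<Rightarrow> 'b::euclidean_space"
  assumes "smooth_on (I \<times> {-1..1}) F" "t \<in> I"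
  shows "smooth_on {-1..1} (\<lambda>x. F (t, x))"
  by (rule smooth_on_compose[OF assms(1)]) (use assms in \<open>auto intro!: smooth_on_intros\<close>)

text \<open>Differences of nearby curves are small in \<open>C\<^sup>4\<close> by uniform continuity on compact time intervals, and
  the \<open>C\<^sup>4\<close> norm dominates.\<close>

lemma smooth_family_continuous_into_Wsp:
  fixes F :: "real \<times> real \<Rightarrow> 'b::euclidean_space"
  assumes p: "p > 5" and F: "smooth_on ({0<..<T} \<times> {-1..1}) F" and t: "t \<in> {0<..<T}"
  shows "((\<lambda>\<tau>. Wsp_norm (4 * (1 - 1 / p)) p (\<lambda>x. F (\<tau>, x) - F (t, x))) \<longlongrightarrow> 0) (at t)"
proof (rule tendstoI)
  let ?J = "{-1..1} :: real set"
  fix e :: real assume "e > 0"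
  define C where "C = 40 powr (1 / p)"
  have "C > 0" by (simp add: C_def)
  define e' where "e' = e / (2 * C)"
  have "e' > 0" using \<open>e > 0\<close> \<open>C > 0\<close> by (simp add: e'_def)
  define D where "D j z = (dx ^^ j) (\<lambda>x. F (fst z, x)) (snd z)" for j z
  define r where "r = min t (T - t) / 2"
  have r: "r > 0" "0 < t - r" "t + r < T" using t by (auto simp: r_def min_def field_simps)
  have "eventually (\<lambda>\<tau>. \<forall>x\<in>?J. norm (D j (\<tau>, x) - D j (t, x)) \<le> e') (at t)" for j
  proof -
    have "continuous_on ({t-r..t+r} \<times> ?J) (D j)"
      unfolding D_def[abs_def]
      using r by (intro continuous_on_subset[OF smooth_on_continuous[OF smooth_family_dx_funpow[OF F]]]) auto
    then have "uniformly_continuous_on ({t-r..t+r} \<times> ?J) (D j)"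
      by (intro compact_uniformly_continuous compact_Times) auto
    then obtain d where d: "d > 0" "\<And>z z'. z \<in> {t-r..t+r} \<times> ?J \<Longrightarrow> z' \<in> {t-r..t+r} \<times> ?J \<Longrightarrow>
        dist z' z < d \<Longrightarrow> dist (D j z') (D j z) < e'"
      unfolding uniformly_continuous_on_def using \<open>e' > 0\<close> by metis
    have "norm (D j (\<tau>, x) - D j (t, x)) \<le> e'" if "dist \<tau> t < min d r" "x \<in> ?J" for \<tau> x
    proof -
      have "dist (\<tau>, x) (t, x) < d" using that by (simp add: dist_Pair_Pair)
      moreover have "\<tau> \<in> {t-r..t+r}" using that by (auto simp: dist_real_def abs_less_iff)
      ultimately have "dist (D j (\<tau>, x)) (D j (t, x)) < e'" using that r by (intro d(2)) auto
      then show ?thesis by (simp add: dist_norm)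
    qed
    then show ?thesis
      unfolding eventually_at using d(1) r by (intro exI[of _ "min d r"]) auto
  qed
  then have "eventually (\<lambda>\<tau>. \<forall>j\<in>{..4::nat}. \<forall>x\<in>?J. norm (D j (\<tau>, x) - D j (t, x)) \<le> e') (at t)"
    by (intro eventually_ball_finite) auto
  moreover have "eventually (\<lambda>\<tau>. \<tau> \<in> {0<..<T}) (at t)"
    using t by (intro eventually_at_in_open') auto
  ultimately show "eventually (\<lambda>\<tau>. dist (Wsp_norm (4 * (1 - 1 / p)) p (\<lambda>x. F (\<tau>, x) - F (t, x))) 0 < e) (at t)"
  proof eventually_elim
    case (elim \<tau>)
    note sm = smooth_family_slice[OF F elim(2)] smooth_family_slice[OF F t]
    have "Wsp_norm (4 * (1 - 1 / p)) p (\<lambda>x. F (\<tau>, x) - F (t, x)) \<le> C * e'"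
      unfolding C_def
      by (rule smooth_Wsp(2)[OF p smooth_on_diff[OF sm]])
         (use elim(1) in \<open>simp add: dx_funpow_diff[OF sm] D_def\<close>)
    also have "\<dots> < e" using \<open>C > 0\<close> \<open>e > 0\<close> by (simp add: e'_def)
    finally show ?case by (simp add: Wsp_norm_def)
  qed
qed

section \<open>The tangential velocity and its removal\<close>

text \<open>In this form the normal projection is expressed by \<open>\<partial>\<^sub>x c\<close> instead of the unit tangent, and the
  coefficient is exactly the vector field that has to be removed.\<close>

lemma perp_altdef:
  assumes "dx c x \<noteq> 0"
  shows "perp c f x = f x - ((f x \<bullet> dx c x) / (dx c x \<bullet> dx c x)) *\<^sub>R dx c x"
  using assms by (simp add: perp_def ds_def power2_norm_eq_inner[symmetric] power2_eq_square)

lemma smooth_family_has_derivative: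
  fixes F :: "real \<times> real \<Rightarrow> 'b::euclidean_space"
  assumes F: "smooth_on ({0<..<T} \<times> {-1..1}) F" and t: "t \<in> {0<..<T}" and x: "x \<in> {-1..1}"
  shows "(F has_derivative (\<lambda>(h, l). h *\<^sub>R dt (\<lambda>t x. F (t, x)) t x + l *\<^sub>R dx (\<lambda>x. F (t, x)) x))
    (at (t, x) within {0<..<T} \<times> {-1..1})"
proof -
  have "Ck_on (Suc 0) ({0<..<T} \<times> {-1..1}) F" using F unfolding smooth_on_def by blast
  then show ?thesis
  proof (rule Ck_on_SucD_partials)
    fix A B
    assume D: "\<And>t x. t \<in> {0<..<T} \<Longrightarrow> x \<in> {-1..1} \<Longrightarrow>
        (F has_derivative (\<lambda>(h, l). h *\<^sub>R A (t, x) + l *\<^sub>R B (t, x))) (at (t, x) within {0<..<T} \<times> {-1..1})"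
      and A: "\<And>t x. t \<in> {0<..<T} \<Longrightarrow> x \<in> {-1..1} \<Longrightarrow>
        ((\<lambda>t. F (t, x)) has_vector_derivative A (t, x)) (at t within {0<..<T})"
      and B: "\<And>t x. t \<in> {0<..<T} \<Longrightarrow> x \<in> {-1..1} \<Longrightarrow>
        ((\<lambda>x. F (t, x)) has_vector_derivative B (t, x)) (at x within {-1..1})"
    have "at t within {0<..<T} = at t" by (rule at_within_open) (use t in auto)
    then have "dt (\<lambda>t x. F (t, x)) t x = A (t, x)"
      using A[OF t x] by (simp add: dt_def vector_derivative_at)
    moreover have "dx (\<lambda>x. F (t, x)) x = B (t, x)"
      by (rule dx_eqI[OF B[OF t x] x])
    ultimately show ?thesis using D[OF t x] by simp
  qed
qed

text \<open>The trajectory of a point that stays in \<open>M\<close> is itself a curve in \<open>M\<close> realising its velocity.\<close>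

lemma velocity_in_tangent_space:
  fixes F :: "real \<times> real \<Rightarrow> 'b::euclidean_space"
  assumes F: "smooth_on ({0<..<T} \<times> J) F" and t: "t \<in> {0<..<T}" and x: "x \<in> J"
    and M: "\<And>t. t \<in> {0<..<T} \<Longrightarrow> F (t, x) \<in> M"
  shows "dt (\<lambda>t x. F (t, x)) t x \<in> tangent_space M (F (t, x))"
proof -
  define e where "e = min t (T - t)"
  have range: "t + s \<in> {0<..<T}" if "s \<in> {-e<..<e}" for s
    using t that by (auto simp: e_def)
  have "0 < e" using t by (auto simp: e_def)
  have smooth: "smooth_on {-e<..<e} (\<lambda>s. F (t + s, x))"
    by (rule smooth_on_compose[OF F]) (use range x in \<open>auto intro!: smooth_on_intros\<close>)
  have "((\<lambda>s. t + s) has_vector_derivative 1) (at (0::real))"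
    by (auto intro!: derivative_eq_intros)
  from vector_diff_chain_at[OF this, of "\<lambda>t. F (t, x)"] smooth_family_has_dt[OF F t x]
  have "((\<lambda>s. F (t + s, x)) has_vector_derivative dt (\<lambda>t x. F (t, x)) t x) (at 0)"
    by (simp add: o_def)
  then show ?thesis
    unfolding tangent_space_def using smooth \<open>0 < e\<close> range M
    by (intro CollectI exI[of _ "\<lambda>s. F (t + s, x)"] exI[of _ e]) auto
qed

theorem corollary1p2:
  fixes M :: "(real ^ 'n) set" and \<xi> :: "real ^ 'n \<Rightarrow> real ^ 'n"
    and p T \<epsilon> :: real
    and \<gamma>\<^sub>0 :: "real \<Rightarrow> real ^ 'n" and \<gamma> :: "real \<Rightarrow> real \<Rightarrow> real ^ 'n"
  assumes "CARD('n) \<ge> 2"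
    and "admissible_hypersurface M \<xi>"
    and "p > 5"
    and "in_Wsp (4 * (1 - 1 / p)) p \<gamma>\<^sub>0"
    and "immersion \<gamma>\<^sub>0"
    and "energy \<gamma>\<^sub>0 > 0"
    and "FBC M \<xi> \<gamma>\<^sub>0"
    and "T > 0"
    and "GP_solution M \<xi> p T \<gamma>\<^sub>0 \<gamma>"
    and "0 < \<epsilon>" and "\<epsilon> < T"
  shows "\<exists>\<phi>. smooth_diffeo_family T \<phi> \<and>
           (\<forall>t x. 0 \<le> t \<and> t < \<epsilon> / 2 \<and> x \<in> {-1..1} \<longrightarrow> \<phi> t x = x) \<and>
           (let \<gamma>' = (\<lambda>t x. \<gamma> t (\<phi> t x)) in
              GP_solution M \<xi> p T \<gamma>\<^sub>0 \<gamma>' \<and>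
              (\<forall>t\<in>{\<epsilon><..<T}. \<forall>x\<in>{-1..1}.
                 dt \<gamma>' t x =
                   - (grad_energy (\<gamma>' t) x - lambda (\<gamma>' t) *\<^sub>R curvature (\<gamma>' t) x)))"
proof -
  let ?J = "{-1..1} :: real set" and ?s = "4 * (1 - 1 / p)"
  note p = \<open>p > 5\<close>
  define F where "F = (\<lambda>(t, x). \<gamma> t x)"
  have F_apply: "F (t, x) = \<gamma> t x" for t x by (simp add: F_def)
  from \<open>GP_solution M \<xi> p T \<gamma>\<^sub>0 \<gamma>\<close> have
    imm: "\<And>t. t \<in> {0..<T} \<Longrightarrow> immersion (\<gamma> t)" and
    F: "smooth_on ({0<..<T} \<times> ?J) F" and
    Wsp: "continuous_into_Wsp ?s p {0..<T} \<gamma>" and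
    init: "\<And>x. x \<in> ?J \<Longrightarrow> \<gamma> 0 x = \<gamma>\<^sub>0 x" and
    FBC: "\<And>t. t \<in> {0..<T} \<Longrightarrow> FBC M \<xi> (\<gamma> t)" and
    energy: "\<And>t. t \<in> {0<..<T} \<Longrightarrow> energy (\<gamma> t) > 0" and
    GP: "\<And>t x. t \<in> {0<..<T} \<Longrightarrow> x \<in> ?J \<Longrightarrow> perp (\<gamma> t) (dt \<gamma> t) x =
             - (grad_energy (\<gamma> t) x - lambda (\<gamma> t) *\<^sub>R curvature (\<gamma> t) x)"
    unfolding GP_solution_def F_def by blast+
  have curve: "smooth_immersed_curve (\<gamma> t)" if "t \<in> {0<..<T}" for t
    unfolding smooth_immersed_curve_def
  proof (intro conjI ballI)
    show "smooth_on ?J (\<gamma> t)" using smooth_family_slice[OF F that] by (simp add: F_apply)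
    show "dx (\<gamma> t) x \<noteq> 0" if "x \<in> ?J" for x
      using imm[of t] that \<open>t \<in> _\<close> by (auto simp: immersion_def)
  qed
  note nz = dx_nonzero[OF curve]

  define gx where "gx z = dx (\<gamma> (fst z)) (snd z)" for z
  define gt where "gt z = dt \<gamma> (fst z) (snd z)" for z
  have smooth_gx: "smooth_on ({0<..<T} \<times> ?J) gx"
    using smooth_family_dx[OF F] by (simp add: gx_def[abs_def] F_apply)
  have smooth_gt: "smooth_on ({0<..<T} \<times> ?J) gt"
    using smooth_family_dt[OF F] by (simp add: gt_def[abs_def] F_apply)
  have gx_nz: "gx z \<noteq> 0" if "z \<in> {0<..<T} \<times> ?J" for z
    using nz that by (auto simp: gx_def)
  \<comment> \<open>The tangential speed of \<open>\<gamma>\<close> measured in the parameter \<open>x\<close>; it has to be cancelled by \<open>\<phi>\<^sub>t\<close>.\<close>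
  define h where "h z = (gt z \<bullet> gx z) / (gx z \<bullet> gx z)" for z
  have smooth_h: "smooth_on ({0<..<T} \<times> ?J) h"
    unfolding h_def[abs_def]
    by (intro smooth_on_divide_pos smooth_on_inner smooth_gx smooth_gt) (use gx_nz in auto)
  \<comment> \<open>The end points move inside \<open>M\<close>, while the curve meets \<open>M\<close> orthogonally.\<close>
  have h_ends: "h (t, x) = 0" if t: "t \<in> {0<..<T}" and x: "x \<in> {-1, 1}" for t x
  proof -
    have xJ: "x \<in> ?J" using x by auto
    have FM: "F (s, x) \<in> M" if "s \<in> {0<..<T}" for s
      using FBC[of s] that x by (auto simp: FBC_def F_apply)
    have "gt (t, x) \<in> tangent_space M (\<gamma> t x)"
      using velocity_in_tangent_space[OF F t xJ FM] by (simp add: F_apply gt_def)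
    then have "ds (\<gamma> t) (\<gamma> t) x \<bullet> gt (t, x) = 0"
      using FBC[of t, unfolded FBC_def, rule_format, OF _ x] t by simp
    then have "gx (t, x) \<bullet> gt (t, x) = 0"
      using nz[OF t xJ] by (simp add: ds_def gx_def)
    then show ?thesis by (simp add: h_def inner_commute)
  qed

  define a where "a = \<epsilon> / 2"
  have a: "0 < a" "a < T" using assms by (auto simp: a_def)
  obtain \<theta> :: "real \<Rightarrow> real" where \<theta>: "smooth_on UNIV \<theta>" "\<And>t. a \<le> t \<Longrightarrow> \<theta> t = t"
    "\<And>t. 0 \<le> t \<Longrightarrow> t < T \<Longrightarrow> 0 < \<theta> t \<and> \<theta> t < T"
    using smooth_time_retraction[OF a] by blast
  define \<eta> where "\<eta> t = smooth_step ((t - a) * (1 / a))" for t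
  have smooth_\<eta>: "smooth_on UNIV \<eta>"
    unfolding \<eta>_def[abs_def]
    by (intro smooth_on_compose[OF smooth_on_smooth_step] smooth_on_intros) auto
  have \<eta>0: "\<eta> t = 0" if "t \<le> a" for t
    unfolding \<eta>_def by (rule smooth_step_0) (use that a in \<open>auto simp: divide_simps\<close>)
  have \<eta>1: "\<eta> t = 1" if "t \<ge> \<epsilon>" for t
    unfolding \<eta>_def by (rule smooth_step_1) (use that a in \<open>auto simp: a_def divide_simps\<close>)
  \<comment> \<open>The argument \<open>\<theta> t\<close> replaces \<open>t\<close> because \<open>h\<close> need not extend smoothly to \<open>t = 0\<close>.  The two agree
    for \<open>t \<ge> a\<close>, and the cutoff \<open>\<eta>\<close> vanishes for \<open>t \<le> a\<close>, so \<open>b\<close> is in effect \<open>- \<eta> h\<close>.\<close>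
  define b where "b z = - (\<eta> (fst z) * h (\<theta> (fst z), snd z))" for z
  have smooth_b: "smooth_on ({0..<T} \<times> ?J) b"
    unfolding b_def[abs_def]
  proof (intro smooth_on_minus smooth_on_mult)
    show "smooth_on ({0..<T} \<times> ?J) (\<lambda>z. \<eta> (fst z))"
      by (rule smooth_on_compose[OF smooth_\<eta> smooth_on_fst]) simp
    have "smooth_on ({0..<T} \<times> ?J) (\<lambda>z. \<theta> (fst z))"
      by (rule smooth_on_compose[OF \<theta>(1) smooth_on_fst]) simp
    then show "smooth_on ({0..<T} \<times> ?J) (\<lambda>z. h (\<theta> (fst z), snd z))"
      by (intro smooth_on_compose[OF smooth_h] smooth_on_Pair smooth_on_snd) (use \<theta>(3) in auto)
  qed
  have b_ends: "b (t, -1) = 0 \<and> b (t, 1) = 0" if "0 \<le> t" "t < T" for t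
    using h_ends[of "\<theta> t"] \<theta>(3)[OF that] by (simp add: b_def)
  have b_late: "b (t, x) = - h (t, x)" if "\<epsilon> \<le> t" for t x
    using that \<eta>1[OF that] \<theta>(2)[of t] a by (simp add: b_def a_def)

  obtain u where u: "smooth_on ({0..<T} \<times> ?J) u"
    and ut: "\<And>t x. 0 \<le> t \<Longrightarrow> t < T \<Longrightarrow> x \<in> ?J \<Longrightarrow>
      ((\<lambda>t. u (t, x)) has_vector_derivative b (t, u (t, x))) (at t within {0..<T})"
    and u0: "\<And>x. u (0, x) = x"
    and u_ends: "\<And>t. 0 \<le> t \<Longrightarrow> t < T \<Longrightarrow> u (t, -1) = -1 \<and> u (t, 1) = 1"
    and uJ: "\<And>t x. 0 \<le> t \<Longrightarrow> t < T \<Longrightarrow> x \<in> ?J \<Longrightarrow> u (t, x) \<in> ?J"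
    and ux_pos: "\<And>t x. 0 \<le> t \<Longrightarrow> t < T \<Longrightarrow> x \<in> ?J \<Longrightarrow> dx (\<lambda>x. u (t, x)) x > 0"
    using smooth_flow_exists[OF \<open>T > 0\<close> smooth_b b_ends] by blast
  define \<phi> where "\<phi> t x = u (t, x)" for t x
  have reparam: "increasing_reparam (\<phi> t)" if "t \<in> {0..<T}" for t
    using that ux_pos[of t] u_ends[of t] smooth_family_slice[OF u that]
    by (auto simp: increasing_reparam_def \<phi>_def[abs_def])
  have \<phi>_early: "\<phi> t x = x" if t: "0 \<le> t" "t \<le> a" and x: "x \<in> ?J" for t x
  proof -
    have "\<exists>c. \<forall>s\<in>{0..a}. u (s, x) = c"
    proof (rule has_field_derivative_zero_constant)
      fix s assume s: "s \<in> {0..a}"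
      then have "b (s, u (s, x)) = 0" using \<eta>0 by (simp add: b_def)
      then have "((\<lambda>t. u (t, x)) has_vector_derivative 0) (at s within {0..a})"
        using ut[of s x] s a x by (auto intro: has_vector_derivative_within_subset)
      then show "((\<lambda>t. u (t, x)) has_field_derivative 0) (at s within {0..a})"
        by (simp add: has_real_derivative_iff_has_vector_derivative)
    qed simp
    then show ?thesis using t a u0[of x] unfolding \<phi>_def by force
  qed

  have family: "smooth_diffeo_family T \<phi>"
    unfolding smooth_diffeo_family_def
  proof (intro conjI ballI)
    show "smooth_on ({0..<T} \<times> ?J) (\<lambda>(t, x). \<phi> t x)" using u by (simp add: \<phi>_def case_prod_beta')
    fix t assume "t \<in> {0..<T}"
    note r = reparam[OF this]
    show "bij_betw (\<phi> t) ?J ?J" "smooth_on ?J (the_inv_into ?J (\<phi> t))"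
      using increasing_reparam_bij_betw[OF r] smooth_on_inverse_reparam[OF r] by auto
    show "smooth_on ?J (\<phi> t)" using r by (simp add: increasing_reparam_def)
  qed

  define \<gamma>' where "\<gamma>' = (\<lambda>t x. \<gamma> t (\<phi> t x))"
  have r: "increasing_reparam (\<phi> t)" if "t \<in> {0<..<T}" for t
    by (rule reparam) (use that in auto)
  note y = phi_range[OF r]
  have early: "\<gamma>' t x = \<gamma> t x" if "0 \<le> t" "t \<le> a" "x \<in> ?J" for t x
    using \<phi>_early[OF that] by (simp add: \<gamma>'_def)
  have F': "smooth_on ({0<..<T} \<times> ?J) (\<lambda>z. F (fst z, u z))"
  proof (rule smooth_on_compose[OF F])
    show "smooth_on ({0<..<T} \<times> ?J) (\<lambda>z. (fst z, u z))"
      by (intro smooth_on_Pair smooth_on_fst smooth_on_subset[OF u]) auto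
    show "(\<lambda>z. (fst z, u z)) ` ({0<..<T} \<times> ?J) \<subseteq> {0<..<T} \<times> ?J" using uJ by force
  qed
  have F'_apply: "F (fst (t, x), u (t, x)) = \<gamma>' t x" for t x
    by (simp add: \<gamma>'_def \<phi>_def F_apply)

  have velocity: "dt \<gamma>' t x = gt (t, \<phi> t x) + b (t, \<phi> t x) *\<^sub>R gx (t, \<phi> t x)"
    if t: "t \<in> {0<..<T}" and x: "x \<in> ?J" for t x
  proof -
    have "((\<lambda>s. u (s, x)) has_vector_derivative b (t, \<phi> t x)) (at t within {0<..<T})"
      using ut[of t x] t x unfolding \<phi>_def
      by (auto intro: has_vector_derivative_within_subset)
    then have inner: "((\<lambda>s. (s, u (s, x))) has_derivative (\<lambda>k. (k, k *\<^sub>R b (t, \<phi> t x)))) (at t within {0<..<T})"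
      unfolding has_vector_derivative_def by (intro has_derivative_Pair has_derivative_ident)
    have "(F has_derivative (\<lambda>(k, l). k *\<^sub>R gt (t, \<phi> t x) + l *\<^sub>R gx (t, \<phi> t x)))
        (at (t, u (t, x)) within {0<..<T} \<times> ?J)"
      using smooth_family_has_derivative[OF F t y[OF t x]] by (simp add: F_apply gt_def gx_def \<phi>_def)
    then have outer: "(F has_derivative (\<lambda>(k, l). k *\<^sub>R gt (t, \<phi> t x) + l *\<^sub>R gx (t, \<phi> t x)))
        (at (t, u (t, x)) within (\<lambda>s. (s, u (s, x))) ` {0<..<T})"
      by (rule has_derivative_subset) (use uJ x in force)
    have "((\<lambda>s. F (s, u (s, x))) has_vector_derivative gt (t, \<phi> t x) + b (t, \<phi> t x) *\<^sub>R gx (t, \<phi> t x))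
        (at t within {0<..<T})"
      using has_derivative_in_compose[OF inner outer]
      by (simp add: has_vector_derivative_def scaleR_add_right)
    moreover have "at t within {0<..<T} = at t" by (rule at_within_open) (use t in auto)
    ultimately show ?thesis
      by (simp add: dt_def vector_derivative_at \<gamma>'_def \<phi>_def F_apply)
  qed
  \<comment> \<open>The two velocities differ by a multiple of the tangent, whatever \<open>b\<close> is.\<close>
  have normal: "perp (\<gamma>' t) (dt \<gamma>' t) x = perp (\<gamma> t) (dt \<gamma> t) (\<phi> t x)"
    if t: "t \<in> {0<..<T}" and x: "x \<in> ?J" for t x
  proof -
    have tangent: "ds (\<gamma>' t) (\<gamma>' t) x = ds (\<gamma> t) (\<gamma> t) (\<phi> t x)"
      using tangent_reparam[OF r curve, OF t t x] by (simp add: \<gamma>'_def)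
    have "perp (\<gamma>' t) (dt \<gamma>' t) x = perp (\<gamma> t) (\<lambda>_. dt \<gamma>' t x) (\<phi> t x)"
      by (simp add: perp_def tangent)
    also have "\<dots> = perp (\<gamma> t) (dt \<gamma> t) (\<phi> t x)"
      using nz[OF t y[OF t x]] velocity[OF t x]
      by (simp add: perp_altdef gt_def gx_def inner_add_left add_divide_distrib scaleR_add_left)
    finally show ?thesis .
  qed
  have rhs: "grad_energy (\<gamma>' t) x - lambda (\<gamma>' t) *\<^sub>R curvature (\<gamma>' t) x =
      grad_energy (\<gamma> t) (\<phi> t x) - lambda (\<gamma> t) *\<^sub>R curvature (\<gamma> t) (\<phi> t x)"
    if t: "t \<in> {0<..<T}" and x: "x \<in> ?J" for t x
  proof -
    show ?thesis
      using grad_energy_reparam[OF r curve, OF t t x] curvature_reparam[OF r curve, OF t t x]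
        lambda_reparam[OF r curve, OF t t] by (simp add: \<gamma>'_def)
  qed

  \<comment> \<open>Near \<open>t = 0\<close> the family is unchanged, at later times it is smooth.\<close>
  have Wsp': "continuous_into_Wsp ?s p {0..<T} \<gamma>'"
    unfolding continuous_into_Wsp_def
  proof (intro conjI ballI)
    fix t assume t: "t \<in> {0..<T}"
    show "in_Wsp ?s p (\<gamma>' t)"
    proof (cases "t \<le> a")
      case True
      then have "in_Wsp ?s p (\<gamma>' t) \<longleftrightarrow> in_Wsp ?s p (\<gamma> t)"
        using early t by (intro in_Wsp_cong) auto
      then show ?thesis using Wsp t by (simp add: continuous_into_Wsp_def)
    next
      case False
      then have "t \<in> {0<..<T}" using a t by auto
      from smooth_in_Wsp[OF p smooth_family_slice[OF F' this]] show ?thesis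
        by (simp only: F'_apply)
    qed
    show "((\<lambda>\<tau>. Wsp_norm ?s p (\<lambda>x. \<gamma>' \<tau> x - \<gamma>' t x)) \<longlongrightarrow> 0) (at t within {0..<T})"
    proof (cases "t < a")
      case True
      have "eventually (\<lambda>\<tau>. \<tau> < a \<and> \<tau> \<in> {0..<T}) (at t within {0..<T})"
        using True by (intro eventually_conj order_tendstoD(2)[OF tendsto_ident_at])
          (auto simp: eventually_at_filter)
      then have "eventually (\<lambda>\<tau>. Wsp_norm ?s p (\<lambda>x. \<gamma> \<tau> x - \<gamma> t x) = Wsp_norm ?s p (\<lambda>x. \<gamma>' \<tau> x - \<gamma>' t x))
          (at t within {0..<T})"
      proof eventually_elim
        case (elim \<tau>)
        show ?case by (rule Wsp_norm_cong) (use early elim t True in auto)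
      qed
      moreover have "((\<lambda>\<tau>. Wsp_norm ?s p (\<lambda>x. \<gamma> \<tau> x - \<gamma> t x)) \<longlongrightarrow> 0) (at t within {0..<T})"
        using Wsp t by (simp add: continuous_into_Wsp_def)
      ultimately show ?thesis by (rule Lim_transform_eventually[rotated])
    next
      case False
      then have "t \<in> {0<..<T}" using a t by auto
      from smooth_family_continuous_into_Wsp[OF p F' this]
      have "((\<lambda>\<tau>. Wsp_norm ?s p (\<lambda>x. \<gamma>' \<tau> x - \<gamma>' t x)) \<longlongrightarrow> 0) (at t)"
        by (simp only: F'_apply)
      then show ?thesis by (rule tendsto_within_subset) simp
    qed
  qed

  have "GP_solution M \<xi> p T \<gamma>\<^sub>0 \<gamma>'"
    unfolding GP_solution_def
  proof (intro conjI ballI)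
    show "continuous_into_Wsp ?s p {0..<T} \<gamma>'" by (rule Wsp')
    show "smooth_on ({0<..<T} \<times> ?J) (\<lambda>(t, x). \<gamma>' t x)"
      using F' by (simp add: case_prod_beta' F'_apply[symmetric])
    show "\<gamma>' 0 x = \<gamma>\<^sub>0 x" if "x \<in> ?J" for x using early[of 0 x] init[OF that] a that by simp
  next
    fix t assume t: "t \<in> {0..<T}"
    have "immersion (\<gamma>' t) \<and> FBC M \<xi> (\<gamma>' t)"
    proof (cases "t = 0")
      case True
      then show ?thesis
        using immersion_cong[of "\<gamma>' t" "\<gamma> t"] FBC_cong[of "\<gamma>' t" "\<gamma> t"] early imm[OF t] FBC[OF t] a by simp
    next
      case False
      then have t': "t \<in> {0<..<T}" using t by auto
      show ?thesis
        using immersion_smooth_curve[OF smooth_immersed_curve_reparam[OF r curve, OF t' t']]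
          FBC_reparam[OF r curve, OF t' t' FBC[OF t]]
        by (simp add: \<gamma>'_def)
    qed
    then show "immersion (\<gamma>' t)" "FBC M \<xi> (\<gamma>' t)" by auto
  next
    fix t assume t: "t \<in> {0<..<T}"
    show "energy (\<gamma>' t) > 0" using energy[OF t] energy_reparam[OF r curve, OF t t] by (simp add: \<gamma>'_def)
    fix x assume x: "x \<in> ?J"
    show "perp (\<gamma>' t) (dt \<gamma>' t) x = - (grad_energy (\<gamma>' t) x - lambda (\<gamma>' t) *\<^sub>R curvature (\<gamma>' t) x)"
      unfolding normal[OF t x] rhs[OF t x] by (rule GP[OF t y[OF t x]])
  qed
  moreover have "dt \<gamma>' t x = - (grad_energy (\<gamma>' t) x - lambda (\<gamma>' t) *\<^sub>R curvature (\<gamma>' t) x)"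
    if "t \<in> {\<epsilon><..<T}" and x: "x \<in> ?J" for t x
  proof -
    have t: "t \<in> {0<..<T}" and late: "\<epsilon> \<le> t" using that \<open>0 < \<epsilon>\<close> by auto
    \<comment> \<open>Here the cutoff is one, so \<open>b = - h\<close> removes precisely the tangential part.\<close>
    have "dt \<gamma>' t x = perp (\<gamma> t) (dt \<gamma> t) (\<phi> t x)"
      using velocity[OF t x] nz[OF t y[OF t x]]
      by (simp add: b_late[OF late] h_def perp_altdef gt_def gx_def)
    also have "\<dots> = - (grad_energy (\<gamma>' t) x - lambda (\<gamma>' t) *\<^sub>R curvature (\<gamma>' t) x)"
      unfolding rhs[OF t x] by (rule GP[OF t y[OF t x]])
    finally show ?thesis .
  qed
  ultimately show ?thesis
    using family \<phi>_early unfolding Let_def \<gamma>'_def a_def by (intro exI[of _ \<phi>]) auto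
qed

end
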